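(* Let $\Upsilon_0$ be an input vocabulary and let $\Upsilon_1$ be the extension of $\Upsilon_0$ with a unary predicate $U$. For an $\Upsilon_1$-structure $A$, let $A_0$ be the $\Upsilon_0$-reduct of the substructure of $A$ with universe $U$. Let $j$ be a positive integer and let $K$ be the class of finite $\Upsilon_1$-structures $A$ with $|A_0|!\le |A|^j$. For every PTime class $K_0$ of $\Upsilon_0$-structures, there exists a PTime ASM program with input vocabulary $\Upsilon_1$ that accepts all $A\in K$ with $A_0\in K_0$ and rejects all $A\in K$ with $A_0\notin K_0$.
   Context: $|A|$ denotes the cardinality of the base set of $A$. Input vocabularies are finite and purely relational. An ordered version of an $\Upsilon_0$-structure $B$ is a structure of vocabulary $\Upsilon_0\cup\{<\}$ (with $<$ a new binary predicate) whose $\Upsilon_0$-reduct is isomorphic to $B$ and in which $<$ is a linear order. A class $K_0$ of finite $\Upsilon_0$-structures is PTime if it is closed under isomorphism and there is a polynomial-time Turing machine that accepts a binary string $s$ if and only if $s$ is the standard encoding of an ordered version of some structure in $K_0$. ASM MODEL. "Object" means an atom (a non-set) or a set. For a finite set $X$ of atoms, $\mathrm{HF}(X)$ is the smallest set $Y$ such that $X\subseteq Y$ and every finite subset of $Y$ is a member of $Y$. $\mathrm{TC}(x)$ is the least transitive set $Y$ with $x\in Y$. Natural numbers are von Neumann ordinals; $\mathit{false}=0=\emptyset$, $\mathit{true}=1=\{\emptyset\}$. Vocabulary: finitely many function names with arities (some marked relational, called predicates), consisting of: static logic predicates ($=$, nullary $\mathit{true},\mathit{false}$, Boolean connectives); static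 set-theoretic names (binary predicate $\in$; nullary $\emptyset$, $\mathrm{Atoms}$; unary $\bigcup$, $\mathrm{TheUnique}$; binary $\mathrm{Pair}$); finitely many static input predicates; finitely many dynamic names, including nullary predicates $\mathrm{Halt}$ and $\mathrm{Output}$. State: a structure with base set $\mathrm{HF}(X)$, $X$ a finite set of atoms. Predicates take values in $\{0,1\}$; Boolean connectives are as usual on $\{0,1\}$ and $0$ if some argument is not Boolean; $\in,\emptyset$ are standard; $\mathrm{Atoms}=X$; $\bigcup a$ is the union of those elements of $a$ that are sets ($\emptyset$ if $a$ is an atom); $\mathrm{TheUnique}(a)$ is the unique element of $a$ if $a$ is a singleton and $\emptyset$ otherwise; $\mathrm{Pair}(a,b)=\{a,b\}$; input predicates hold only of tuples of atoms; for each dynamic $f$ of arity $j$ the set $\mathrm{Extent}(f)=\{(x_0,\dots,x_j): f(x_0,\dots,x_{j-1})=x_j\neq 0\}$ is finite. An input structure is a finite structure of the input vocabulary (replaced by an isomorphic copy whose elements are atoms); it determines the initial state whose atoms with the input predicates form that structure and in which all dynamic functions have empty extent. Terms: variables; $f(t_1,\dots,t_j)$ (Boolean if $f$ is a predicate); $\{t(v):v\in r:g(v)\}$ with $r$ a term without $v$ free and $g$ a Boolean term ($v$ becomes bound), whose value is the set of values of $t(v)$ for those $v\in r$ with $g(v)$ true. Rules: Skip; $f(t_1,\dots,t_j):=t_0$ with $f$ dynamic ($t_0$ Boolean if $f$ is relational); "if $g$ then $R_1$ else $R_2$ endif" with $g$ a Boolean term; "do forall $v\in r$, $R_0(v)$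 enddo" with $r$ a term without $v$ free ($v$ becomes bound). An expanded state is a state with an assignment of values to finitely many variables; $A(v\mapsto a)$ is $A$ with $v$ (re)assigned $a$. $\mathrm{Den}(R,A)$ is a set of updates $(f,\bar a,b)$: $\mathrm{Den}(\text{Skip},A)=\emptyset$; for $f(\bar s):=t$ it is $\{(f,\mathrm{Val}_A(\bar s),\mathrm{Val}_A(t))\}$; for a conditional it is $\mathrm{Den}(R_1,A)$ or $\mathrm{Den}(R_2,A)$ according as $g$ is true or not in $A$; for do-forall it is $\bigcup\{\mathrm{Den}(R_0(v),A(v\mapsto a)):a\in\mathrm{Val}_A(r)\}$. The sequel of $A$ with respect to $R$ is obtained by simultaneously setting $f(\bar a)=b$ for all $(f,\bar a,b)\in\mathrm{Den}(R,A)$ if no two updates clash (same $(f,\bar a)$, different $b$); otherwise it is the state $A$ itself. A program is a rule without free variables. The run of a program $\Pi$ on an input structure $I$ is the finite or infinite sequence $A_0,A_1,\dots$ with $A_0$ the initial state of $I$ and each $A_{i+1}$ the sequel of $A_i$ with respect to $\Pi$, which stops at the first state in which $\mathrm{Halt}$ holds (and is infinite if there is none). The length of a finite run $\langle A_i:i\le l\rangle$ is $l$. PTIME PROGRAMS. An object is critical at a state if it is an atom, or $0$ or $1$, or a value of a dynamic function, or a component of a location (argument tuple) where some dynamic function takes a value different from $\emptyset$. It is active at a state if it belongs to $\mathrm{TC}(y)$ for some critical $y$, and active in a run if active at some state of the run. A PTime (ASM) program is $\bar\Pi=(\Pi,p(n),q(n))$ with $\Pi$ a program and $p,q$ integer polynomials;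 its run on an input structure $I$ of size $n$ is the longest initial segment of the run of $\Pi$ on $I$ that has length $\le p(n)$ and at most $q(n)$ active objects. $\bar\Pi$ accepts (rejects) $I$ if this run halts (i.e. $\mathrm{Halt}$ holds in its final state) and $\mathrm{Output}$ is true (false) in the final state. *)

theory Defs
  imports "HOL-Library.FSet" "HOL-Computational_Algebra.Polynomial"
begin

section \<open>Finite relational structures\<close>

text \<open>
  A vocabulary is the list of the arities of its predicates: the symbols are the positions in the
  list, and adding a new predicate of arity \<open>r\<close> to \<open>\<Upsilon>\<close> gives \<open>\<Upsilon> @ [r]\<close>. Elements of structures
  are taken from \<^typ>\<open>nat\<close>; up to isomorphism this covers all finite structures.
  The empty structure is admitted.
\<close>

type_synonym vocabulary = "nat list"

record fin_struct =
  universe :: "nat set"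
  rels :: "nat list set list"

definition is_struct :: "vocabulary \<Rightarrow> fin_struct \<Rightarrow> bool" where
  "is_struct \<Upsilon> S \<longleftrightarrow> finite (universe S) \<and>
     list_all2 (\<lambda>r R. R \<subseteq> {xs. length xs = r \<and> set xs \<subseteq> universe S}) \<Upsilon> (rels S)"

definition iso :: "fin_struct \<Rightarrow> fin_struct \<Rightarrow> bool" where
  "iso S T \<longleftrightarrow> (\<exists>h. bij_betw h (universe S) (universe T) \<and> rels T = map (\<lambda>R. map h ` R) (rels S))"

definition substructure :: "fin_struct \<Rightarrow> nat set \<Rightarrow> fin_struct" where
  "substructure S W = \<lparr>universe = W, rels = map (\<lambda>R. R \<inter> lists W) (rels S)\<rparr>"

definition reduct :: "vocabulary \<Rightarrow> fin_struct \<Rightarrow> fin_struct" where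
  "reduct \<Upsilon> S = \<lparr>universe = universe S, rels = take (length \<Upsilon>) (rels S)\<rparr>"

text \<open>For a structure \<open>A\<close> of vocabulary \<open>\<Upsilon> @ [1]\<close>: the set \<open>U\<close> and the structure \<open>A\<^sub>0\<close>.\<close>

definition U_set :: "vocabulary \<Rightarrow> fin_struct \<Rightarrow> nat set" where
  "U_set \<Upsilon> A = {x. [x] \<in> rels A ! length \<Upsilon>}"

definition U_part :: "vocabulary \<Rightarrow> fin_struct \<Rightarrow> fin_struct" where
  "U_part \<Upsilon> A = reduct \<Upsilon> (substructure A (U_set \<Upsilon> A))"


section \<open>Polynomial-time Turing machines\<close>

text \<open>
  Deterministic machines with one two-way infinite tape. States are the numbers below
  \<open>tm_states\<close> (\<open>0\<close> is initial), tape symbols the numbers below \<open>tm_symbols\<close>: \<open>0\<close> is the blank,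
  \<open>1\<close> and \<open>2\<close> are the input bits.
\<close>

record tm =
  tm_states :: nat
  tm_symbols :: nat
  tm_delta :: "nat \<Rightarrow> nat \<Rightarrow> nat \<times> nat \<times> int"
  tm_accept :: nat
  tm_reject :: nat

definition is_tm :: "tm \<Rightarrow> bool" where
  "is_tm M \<longleftrightarrow> 3 \<le> tm_symbols M \<and> 0 < tm_states M \<and>
     tm_accept M < tm_states M \<and> tm_reject M < tm_states M \<and> tm_accept M \<noteq> tm_reject M \<and>
     (\<forall>q < tm_states M. \<forall>a < tm_symbols M.
        tm_delta M q a \<in> {..<tm_states M} \<times> {..<tm_symbols M} \<times> {-1, 0, 1})"

text \<open>A configuration consists of the state, the position of the head, and the tape.\<close>

type_synonym tm_config = "nat \<times> int \<times> (int \<Rightarrow> nat)"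

definition tm_step :: "tm \<Rightarrow> tm_config \<Rightarrow> tm_config" where
  "tm_step M = (\<lambda>(q, h, tape).
     if q = tm_accept M \<or> q = tm_reject M then (q, h, tape)
     else (case tm_delta M q (tape h) of (q', a, d) \<Rightarrow> (q', h + d, tape(h := a))))"

definition tm_init :: "bool list \<Rightarrow> tm_config" where
  "tm_init s = (0, 0, \<lambda>i. if 0 \<le> i \<and> nat i < length s then (if s ! nat i then 2 else 1) else 0)"

definition tm_state_at :: "tm \<Rightarrow> bool list \<Rightarrow> nat \<Rightarrow> nat" where
  "tm_state_at M s t = fst ((tm_step M ^^ t) (tm_init s))"

definition tm_accepts :: "tm \<Rightarrow> bool list \<Rightarrow> bool" where
  "tm_accepts M s \<longleftrightarrow> (\<exists>t. tm_state_at M s t = tm_accept M)"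

definition tm_polytime :: "tm \<Rightarrow> bool" where
  "tm_polytime M \<longleftrightarrow> (\<exists>p :: nat poly. \<forall>s.
     tm_state_at M s (poly p (length s)) \<in> {tm_accept M, tm_reject M})"


section \<open>PTime classes of structures\<close>

text \<open>
  The order \<open><\<close> is the last relation of an ordered structure. \<open>ordered_version \<Upsilon> B C\<close> means that
  \<open>C\<close> is an ordered version of \<open>B\<close>.
\<close>

definition less_of :: "fin_struct \<Rightarrow> (nat \<times> nat) set" where
  "less_of C = {(x, y). [x, y] \<in> last (rels C)}"

definition ordered_version :: "vocabulary \<Rightarrow> fin_struct \<Rightarrow> fin_struct \<Rightarrow> bool" where
  "ordered_version \<Upsilon> B C \<longleftrightarrow> is_struct (\<Upsilon> @ [2]) C \<and> iso (reduct \<Upsilon> C) B \<and>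
     strict_linear_order_on (universe C) (less_of C)"

definition enumeration :: "fin_struct \<Rightarrow> nat list" where
  "enumeration C = (THE xs. distinct xs \<and> set xs = universe C \<and>
     sorted_wrt (\<lambda>x y. (x, y) \<in> less_of C) xs)"

text \<open>
  The encoding of an ordered structure is \<open>1\<^sup>n 0\<close>, for \<open>n\<close> the size of the universe, followed by the
  bit strings of the relations; the bits of an \<open>r\<close>-ary relation are its truth values at the \<open>n\<^sup>r\<close>
  tuples in lexicographic order.
\<close>

definition encoding :: "vocabulary \<Rightarrow> fin_struct \<Rightarrow> bool list" where
  "encoding \<Upsilon> C = (let xs = enumeration C in
     replicate (length xs) True @ [False] @
     concat (map2 (\<lambda>r R. map (\<lambda>t. t \<in> R) (product_lists (replicate r xs))) \<Upsilon> (rels C)))"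

definition ptime_class :: "vocabulary \<Rightarrow> fin_struct set \<Rightarrow> bool" where
  "ptime_class \<Upsilon> K \<longleftrightarrow>
     (\<forall>B \<in> K. is_struct \<Upsilon> B) \<and>
     (\<forall>B \<in> K. \<forall>C. is_struct \<Upsilon> C \<and> iso B C \<longrightarrow> C \<in> K) \<and>
     (\<exists>M. is_tm M \<and> tm_polytime M \<and>
        (\<forall>s. tm_accepts M s \<longleftrightarrow>
           (\<exists>B \<in> K. \<exists>C. ordered_version \<Upsilon> B C \<and> s = encoding (\<Upsilon> @ [2]) C)))"


section \<open>Objects\<close>

datatype obj = Atom nat | HSet "obj fset"

fun elems :: "obj \<Rightarrow> obj fset" where
  "elems (Atom x) = {||}"
| "elems (HSet s) = s"

inductive_set HF :: "nat set \<Rightarrow> obj set" for X :: "nat set" where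
  Atom: "x \<in> X \<Longrightarrow> Atom x \<in> HF X"
| HSet: "(\<And>y. y |\<in>| s \<Longrightarrow> y \<in> HF X) \<Longrightarrow> HSet s \<in> HF X"

inductive_set TC :: "obj \<Rightarrow> obj set" for x :: obj where
  self: "x \<in> TC x"
| elem: "y \<in> TC x \<Longrightarrow> z |\<in>| elems y \<Longrightarrow> z \<in> TC x"

definition ff :: obj where "ff = HSet {||}"
definition tt :: obj where "tt = HSet {|ff|}"

definition bool_obj :: "bool \<Rightarrow> obj" where
  "bool_obj b = (if b then tt else ff)"

definition is_bool :: "obj \<Rightarrow> bool" where
  "is_bool x \<longleftrightarrow> x = ff \<or> x = tt"


section \<open>Vocabularies and states of abstract state machines\<close>

datatype dname = Halt | Output | Aux nat

datatype fname =
    Eq | TrueF | FalseF | NotF | AndF | OrF | ImpF | IffF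
  | InF | EmptyF | AtomsF | UnionF | TheUniqueF | PairF
  | Inp nat
  | Dyn dname

text \<open>
  The dynamic vocabulary of a program consists of \<open>Halt\<close>, \<open>Output\<close> and a list giving, for each
  further dynamic name, its arity and whether it is relational.
\<close>

type_synonym dyn_vocabulary = "(nat \<times> bool) list"

fun dyn_arity :: "dyn_vocabulary \<Rightarrow> dname \<Rightarrow> nat" where
  "dyn_arity D (Aux i) = fst (D ! i)"
| "dyn_arity D _ = 0"

fun dyn_relational :: "dyn_vocabulary \<Rightarrow> dname \<Rightarrow> bool" where
  "dyn_relational D (Aux i) = snd (D ! i)"
| "dyn_relational D _ = True"

fun dyn_valid :: "dyn_vocabulary \<Rightarrow> dname \<Rightarrow> bool" where
  "dyn_valid D (Aux i) = (i < length D)"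
| "dyn_valid D _ = True"

definition arity :: "vocabulary \<Rightarrow> dyn_vocabulary \<Rightarrow> fname \<Rightarrow> nat" where
  "arity \<Upsilon> D f = (case f of
       Inp i \<Rightarrow> \<Upsilon> ! i
     | Dyn g \<Rightarrow> dyn_arity D g
     | _ \<Rightarrow> if f \<in> {TrueF, FalseF, EmptyF, AtomsF} then 0
           else if f \<in> {NotF, UnionF, TheUniqueF} then 1 else 2)"

definition relational :: "dyn_vocabulary \<Rightarrow> fname \<Rightarrow> bool" where
  "relational D f = (case f of
       Dyn g \<Rightarrow> dyn_relational D g
     | _ \<Rightarrow> f \<notin> {EmptyF, AtomsF, UnionF, TheUniqueF, PairF})"

definition valid :: "vocabulary \<Rightarrow> dyn_vocabulary \<Rightarrow> fname \<Rightarrow> bool" where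
  "valid \<Upsilon> D f = (case f of
       Inp i \<Rightarrow> i < length \<Upsilon>
     | Dyn g \<Rightarrow> dyn_valid D g
     | _ \<Rightarrow> True)"

text \<open>
  In a state, the atoms and the input predicates form the structure \<open>input\<close>. The dynamic functions
  are total on lists of objects; they are \<open>\<emptyset>\<close> outside the vocabulary and the base set.
\<close>

record state =
  input :: fin_struct
  dyn :: "dname \<Rightarrow> obj list \<Rightarrow> obj"

definition base_set :: "state \<Rightarrow> obj set" where
  "base_set A = HF (universe (input A))"

definition extent :: "state \<Rightarrow> dname \<Rightarrow> (obj list \<times> obj) set" where
  "extent A f = {(xs, y). dyn A f xs = y \<and> y \<noteq> ff}"

definition is_state :: "vocabulary \<Rightarrow> dyn_vocabulary \<Rightarrow> state \<Rightarrow> bool" where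
  "is_state \<Upsilon> D A \<longleftrightarrow> is_struct \<Upsilon> (input A) \<and>
     (\<forall>f. finite (extent A f) \<and>
        (\<forall>(xs, y) \<in> extent A f. dyn_valid D f \<and> length xs = dyn_arity D f \<and>
           set xs \<subseteq> base_set A \<and> y \<in> base_set A \<and> (dyn_relational D f \<longrightarrow> y = tt)))"

definition initial_state :: "fin_struct \<Rightarrow> state" where
  "initial_state I = \<lparr>input = I, dyn = (\<lambda>_ _. ff)\<rparr>"

definition interp :: "state \<Rightarrow> fname \<Rightarrow> obj list \<Rightarrow> obj" where
  "interp A f xs = (let x = xs ! 0; y = xs ! 1 in case f of
       Eq \<Rightarrow> bool_obj (x = y)
     | TrueF \<Rightarrow> tt
     | FalseF \<Rightarrow> ff
     | NotF \<Rightarrow> bool_obj (is_bool x \<and> x \<noteq> tt)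
     | AndF \<Rightarrow> bool_obj (is_bool x \<and> is_bool y \<and> (x = tt \<and> y = tt))
     | OrF \<Rightarrow> bool_obj (is_bool x \<and> is_bool y \<and> (x = tt \<or> y = tt))
     | ImpF \<Rightarrow> bool_obj (is_bool x \<and> is_bool y \<and> (x = tt \<longrightarrow> y = tt))
     | IffF \<Rightarrow> bool_obj (is_bool x \<and> is_bool y \<and> (x = tt \<longleftrightarrow> y = tt))
     | InF \<Rightarrow> bool_obj (x |\<in>| elems y)
     | EmptyF \<Rightarrow> HSet {||}
     | AtomsF \<Rightarrow> HSet (Abs_fset (Atom ` universe (input A)))
     | UnionF \<Rightarrow> HSet (ffUnion (elems |`| elems x))
     | TheUniqueF \<Rightarrow> if \<exists>z. elems x = {|z|} then THE z. elems x = {|z|} else HSet {||}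
     | PairF \<Rightarrow> HSet {|x, y|}
     | Inp i \<Rightarrow> bool_obj (xs \<in> map Atom ` (rels (input A) ! i))
     | Dyn g \<Rightarrow> dyn A g xs)"


section \<open>Terms\<close>

text \<open>\<open>Compr t v r g\<close> is the term \<open>{t(v) : v \<in> r : g(v)}\<close>.\<close>

datatype trm = Var nat | App fname "trm list" | Compr trm nat trm trm

fun bool_trm :: "dyn_vocabulary \<Rightarrow> trm \<Rightarrow> bool" where
  "bool_trm D (App f ts) = relational D f"
| "bool_trm D _ = False"

fun fv_trm :: "trm \<Rightarrow> nat set" where
  "fv_trm (Var v) = {v}"
| "fv_trm (App f ts) = (\<Union>t \<in> set ts. fv_trm t)"
| "fv_trm (Compr t v r g) = fv_trm r \<union> ((fv_trm t \<union> fv_trm g) - {v})"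

fun wf_trm :: "vocabulary \<Rightarrow> dyn_vocabulary \<Rightarrow> trm \<Rightarrow> bool" where
  "wf_trm \<Upsilon> D (Var v) = True"
| "wf_trm \<Upsilon> D (App f ts) =
     (valid \<Upsilon> D f \<and> length ts = arity \<Upsilon> D f \<and> (\<forall>t \<in> set ts. wf_trm \<Upsilon> D t))"
| "wf_trm \<Upsilon> D (Compr t v r g) =
     (wf_trm \<Upsilon> D t \<and> wf_trm \<Upsilon> D r \<and> wf_trm \<Upsilon> D g \<and> v \<notin> fv_trm r \<and> bool_trm D g)"

text \<open>
  An expanded state is a state \<open>A\<close> with an assignment \<open>e\<close>. Assignments are total; values of
  variables that are not free do not matter.
\<close>

fun val :: "state \<Rightarrow> (nat \<Rightarrow> obj) \<Rightarrow> trm \<Rightarrow> obj" where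
  "val A e (Var v) = e v"
| "val A e (App f ts) = interp A f (map (val A e) ts)"
| "val A e (Compr t v r g) =
     HSet ((\<lambda>a. val A (e(v := a)) t) |`| ffilter (\<lambda>a. val A (e(v := a)) g = tt) (elems (val A e r)))"


section \<open>Rules and runs\<close>

datatype asm_rule =
    Skip
  | Update dname "trm list" trm
  | Cond trm asm_rule asm_rule
  | Forall nat trm asm_rule

primrec fv_rule :: "asm_rule \<Rightarrow> nat set" where
  "fv_rule Skip = {}"
| "fv_rule (Update f ts t) = (\<Union>s \<in> set ts. fv_trm s) \<union> fv_trm t"
| "fv_rule (Cond g R1 R2) = fv_trm g \<union> fv_rule R1 \<union> fv_rule R2"
| "fv_rule (Forall v r R) = fv_trm r \<union> (fv_rule R - {v})"

primrec wf_rule :: "vocabulary \<Rightarrow> dyn_vocabulary \<Rightarrow> asm_rule \<Rightarrow> bool" where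
  "wf_rule \<Upsilon> D Skip = True"
| "wf_rule \<Upsilon> D (Update f ts t) =
     (dyn_valid D f \<and> length ts = dyn_arity D f \<and> (\<forall>s \<in> set ts. wf_trm \<Upsilon> D s) \<and>
      wf_trm \<Upsilon> D t \<and> (dyn_relational D f \<longrightarrow> bool_trm D t))"
| "wf_rule \<Upsilon> D (Cond g R1 R2) =
     (wf_trm \<Upsilon> D g \<and> bool_trm D g \<and> wf_rule \<Upsilon> D R1 \<and> wf_rule \<Upsilon> D R2)"
| "wf_rule \<Upsilon> D (Forall v r R) = (wf_trm \<Upsilon> D r \<and> v \<notin> fv_trm r \<and> wf_rule \<Upsilon> D R)"

type_synonym update = "dname \<times> obj list \<times> obj"

primrec den :: "asm_rule \<Rightarrow> state \<Rightarrow> (nat \<Rightarrow> obj) \<Rightarrow> update set" where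
  "den Skip A e = {}"
| "den (Update f ts t) A e = {(f, map (val A e) ts, val A e t)}"
| "den (Cond g R1 R2) A e = (if val A e g = tt then den R1 A e else den R2 A e)"
| "den (Forall v r R) A e = (\<Union>a \<in> fset (elems (val A e r)). den R A (e(v := a)))"

definition clash :: "update set \<Rightarrow> bool" where
  "clash D \<longleftrightarrow> (\<exists>f xs b b'. (f, xs, b) \<in> D \<and> (f, xs, b') \<in> D \<and> b \<noteq> b')"

definition apply_updates :: "update set \<Rightarrow> state \<Rightarrow> state" where
  "apply_updates D A = A\<lparr>dyn := (\<lambda>f xs.
     if \<exists>b. (f, xs, b) \<in> D then THE b. (f, xs, b) \<in> D else dyn A f xs)\<rparr>"

text \<open>The sequel is only taken for rules without free variables, so any assignment will do.\<close>

definition sequel :: "asm_rule \<Rightarrow> state \<Rightarrow> state" where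
  "sequel R A = (let D = den R A (\<lambda>_. ff) in if clash D then A else apply_updates D A)"

record program =
  dyn_voc :: dyn_vocabulary
  body :: asm_rule

definition is_program :: "vocabulary \<Rightarrow> program \<Rightarrow> bool" where
  "is_program \<Upsilon> \<Pi> \<longleftrightarrow> wf_rule \<Upsilon> (dyn_voc \<Pi>) (body \<Pi>) \<and> fv_rule (body \<Pi>) = {}"

definition halted :: "state \<Rightarrow> bool" where
  "halted A \<longleftrightarrow> dyn A Halt [] = tt"

definition run_state :: "program \<Rightarrow> fin_struct \<Rightarrow> nat \<Rightarrow> state" where
  "run_state \<Pi> I i = (sequel (body \<Pi>) ^^ i) (initial_state I)"

text \<open>The run of \<open>\<Pi>\<close> on \<open>I\<close> has an initial segment \<open>A\<^sub>0, \<dots>, A\<^sub>l\<close> of length \<open>l\<close>.\<close>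

definition run_reaches :: "program \<Rightarrow> fin_struct \<Rightarrow> nat \<Rightarrow> bool" where
  "run_reaches \<Pi> I l \<longleftrightarrow> (\<forall>i < l. \<not> halted (run_state \<Pi> I i))"


section \<open>PTime programs\<close>

definition critical :: "state \<Rightarrow> obj set" where
  "critical A = Atom ` universe (input A) \<union> {ff, tt} \<union>
     {dyn A f xs | f xs. True} \<union> {x. \<exists>f xs. x \<in> set xs \<and> dyn A f xs \<noteq> ff}"

definition active :: "state \<Rightarrow> obj set" where
  "active A = (\<Union>y \<in> critical A. TC y)"

record ptime_program =
  prog :: program
  time_poly :: "int poly"
  space_poly :: "int poly"

definition is_ptime_program :: "vocabulary \<Rightarrow> ptime_program \<Rightarrow> bool" where
  "is_ptime_program \<Upsilon> P \<longleftrightarrow> is_program \<Upsilon> (prog P)"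

definition bounded_segment :: "ptime_program \<Rightarrow> fin_struct \<Rightarrow> nat \<Rightarrow> bool" where
  "bounded_segment P I l \<longleftrightarrow> run_reaches (prog P) I l \<and>
     int l \<le> poly (time_poly P) (int (card (universe I))) \<and>
     (let Act = (\<Union>i \<le> l. active (run_state (prog P) I i))
      in finite Act \<and> int (card Act) \<le> poly (space_poly P) (int (card (universe I))))"

definition ptime_run_length :: "ptime_program \<Rightarrow> fin_struct \<Rightarrow> nat \<Rightarrow> bool" where
  "ptime_run_length P I l \<longleftrightarrow> bounded_segment P I l \<and> (\<forall>m > l. \<not> bounded_segment P I m)"

definition accepts :: "ptime_program \<Rightarrow> fin_struct \<Rightarrow> bool" where
  "accepts P I \<longleftrightarrow> (\<exists>l. ptime_run_length P I l \<and> halted (run_state (prog P) I l) \<and>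
     dyn (run_state (prog P) I l) Output [] = tt)"

definition rejects :: "ptime_program \<Rightarrow> fin_struct \<Rightarrow> bool" where
  "rejects P I \<longleftrightarrow> (\<exists>l. ptime_run_length P I l \<and> halted (run_state (prog P) I l) \<and>
     dyn (run_state (prog P) I l) Output [] = ff)"


section \<open>Runs consist of states\<close>

text \<open>
  The states in a run of a program satisfy \<^const>\<open>is_state\<close>, with all values in the base set, and
  have finitely many active objects; so the finiteness condition in \<^const>\<open>bounded_segment\<close> holds
  automatically.
\<close>

lemma HF_ff: "ff \<in> HF X" and HF_tt: "tt \<in> HF X"
  unfolding tt_def ff_def by (auto intro!: HF.intros)

lemma HF_bool: "bool_obj b \<in> HF X"
  by (simp add: bool_obj_def HF_ff HF_tt)

lemma is_bool_bool_obj [simp]: "is_bool (bool_obj b)" "is_bool tt" "is_bool ff"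
  by (auto simp: bool_obj_def is_bool_def)

lemma HF_elems: "x \<in> HF X \<Longrightarrow> y |\<in>| elems x \<Longrightarrow> y \<in> HF X"
  by (auto elim: HF.cases)

lemma dyn_state:
  assumes "is_state \<Upsilon> D A"
  shows "dyn A f xs \<in> base_set A" "dyn_relational D f \<Longrightarrow> is_bool (dyn A f xs)"
proof -
  have "dyn A f xs = ff \<or> (xs, dyn A f xs) \<in> extent A f" by (auto simp: extent_def)
  then show "dyn A f xs \<in> base_set A" "dyn_relational D f \<Longrightarrow> is_bool (dyn A f xs)"
    using assms by (auto simp: is_state_def is_bool_def base_set_def HF_ff)
qed

lemma interp_bool:
  assumes "is_state \<Upsilon> D A" "relational D f"
  shows "is_bool (interp A f xs)"
  using assms by (cases f) (auto simp: interp_def relational_def Let_def dyn_state)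

lemma interp_HF:
  assumes st: "is_state \<Upsilon> D A" and "length xs = arity \<Upsilon> D f" "set xs \<subseteq> base_set A"
  shows "interp A f xs \<in> base_set A"
proof -
  have fin: "finite (universe (input A))" using st by (auto simp: is_state_def is_struct_def)
  have U: "HSet (ffUnion (elems |`| elems x)) \<in> HF X" if "x \<in> HF X" for x X
  proof (rule HF.HSet)
    fix y assume "y |\<in>| ffUnion (elems |`| elems x)"
    then obtain z where "z |\<in>| elems x" "y |\<in>| elems z" by (auto simp: ffUnion.rep_eq)
    then show "y \<in> HF X" using that HF_elems by blast
  qed
  have At: "HSet (Abs_fset (Atom ` X)) \<in> HF X" if "finite X" for X
    using that by (intro HF.HSet) (auto simp: Abs_fset_inverse intro: HF.Atom)
  have 0: "xs ! 0 \<in> base_set A" if "0 < length xs" using that assms(3) nth_mem by blast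
  have 1: "xs ! 1 \<in> base_set A" if "1 < length xs" using that assms(3) nth_mem by blast
  show ?thesis
    using assms(2) 0 1 fin
    by (cases f) (auto simp: interp_def Let_def arity_def base_set_def HF_bool HF_ff HF_tt
        Abs_fset_inverse dyn_state[OF st, unfolded base_set_def]
        intro!: U At intro: HF.intros dest: HF_elems)
qed

lemma val_HF:
  assumes "is_state \<Upsilon> D A" "wf_trm \<Upsilon> D t" "\<And>v. e v \<in> base_set A"
  shows "val A e t \<in> base_set A"
  using assms(2,3)
proof (induction t arbitrary: e)
  case (Var x) then show ?case by simp
next
  case (App f ts)
  then show ?case using interp_HF[OF assms(1)] by (auto simp: image_subset_iff)
next
  case (Compr t v r g)
  then have "val A e r \<in> base_set A" by simp
  then have "val A (e(v := a)) t \<in> base_set A" if "a |\<in>| elems (val A e r)" for a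
    using Compr.prems that HF_elems[of "val A e r" "universe (input A)" a]
    by (intro Compr.IH) (auto simp: base_set_def)
  then show ?case by (auto simp: base_set_def intro!: HF.HSet)
qed

lemma val_bool: "is_state \<Upsilon> D A \<Longrightarrow> bool_trm D t \<Longrightarrow> is_bool (val A e t)"
  by (cases t) (auto intro: interp_bool)

lemma finite_den: "finite (den R A e)"
  by (induction R arbitrary: e) auto

lemma den_ok:
  assumes "is_state \<Upsilon> D A" "wf_rule \<Upsilon> D R" "\<And>v. e v \<in> base_set A" "(f, xs, b) \<in> den R A e"
  shows "dyn_valid D f \<and> length xs = dyn_arity D f \<and> set xs \<subseteq> base_set A \<and> b \<in> base_set A \<and>
     (dyn_relational D f \<longrightarrow> is_bool b)"
  using assms(2-)
proof (induction R arbitrary: e)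
  case (Forall v r R)
  then obtain a where a: "a |\<in>| elems (val A e r)" "(f, xs, b) \<in> den R A (e(v := a))" by auto
  have "val A e r \<in> base_set A" using Forall.prems val_HF[OF assms(1)] by simp
  with a(1) have "a \<in> base_set A" by (auto simp: base_set_def dest: HF_elems)
  then show ?case using Forall.prems(1,2) by (intro Forall.IH[OF _ _ a(2)]) auto
qed (auto split: if_splits intro: val_HF[OF assms(1)] val_bool[OF assms(1)])

lemma sequel_state:
  assumes st: "is_state \<Upsilon> D A" and wf: "wf_rule \<Upsilon> D R"
  shows "is_state \<Upsilon> D (sequel R A)"
proof (cases "clash (den R A (\<lambda>_. ff))")
  case True then show ?thesis using st by (simp add: sequel_def)
next
  case False
  let ?N = "den R A (\<lambda>_. ff)" and ?B = "sequel R A"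
  have inp: "input ?B = input A" using False by (simp add: sequel_def apply_updates_def Let_def)
  then have bs: "base_set ?B = base_set A" by (simp add: base_set_def)
  have d: "(f, xs, dyn ?B f xs) \<in> ?N \<or> dyn ?B f xs = dyn A f xs" for f xs
  proof (cases "\<exists>b. (f, xs, b) \<in> ?N")
    case True
    then have "\<exists>!b. (f, xs, b) \<in> ?N" using False unfolding clash_def by blast
    from theI'[OF this] True False show ?thesis by (simp add: sequel_def apply_updates_def Let_def)
  next
    case nex: False
    then show ?thesis using False by (simp add: sequel_def apply_updates_def Let_def)
  qed
  have sub: "extent ?B f \<subseteq> extent A f \<union> {(xs, b). (f, xs, b) \<in> ?N}" for f
    using d[of f] by (force simp: extent_def)
  have "finite {(xs, b). (f, xs, b) \<in> ?N}" for f
    by (rule finite_subset[OF _ finite_imageI[OF finite_den[of R A "\<lambda>_. ff"], of snd]]) force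
  then have fin: "finite (extent ?B f)" for f
    using sub[of f] st by (meson finite_UnI finite_subset is_state_def)
  have "dyn_valid D f \<and> length xs = dyn_arity D f \<and> set xs \<subseteq> base_set A \<and> y \<in> base_set A \<and>
      (dyn_relational D f \<longrightarrow> y = tt)" if "(xs, y) \<in> extent ?B f" for f xs y
  proof (cases "(xs, y) \<in> extent A f")
    case True then show ?thesis using st by (fastforce simp: is_state_def)
  next
    case False
    then have "(f, xs, y) \<in> ?N" using that sub[of f] by auto
    moreover have "y \<noteq> ff" using that by (simp add: extent_def)
    ultimately show ?thesis using den_ok[OF st wf, of "\<lambda>_. ff" f xs y]
      by (auto simp: base_set_def HF_ff is_bool_def)
  qed
  then show ?thesis using st fin unfolding is_state_def bs inp by blast
qed

lemma is_state_run_state: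
  assumes "is_program \<Upsilon> \<Pi>" "is_struct \<Upsilon> I"
  shows "is_state \<Upsilon> (dyn_voc \<Pi>) (run_state \<Pi> I i)"
proof (induction i)
  case 0
  have "extent (initial_state I) f = {}" for f by (auto simp: extent_def initial_state_def)
  then show ?case using assms
    by (simp add: run_state_def is_state_def) (simp add: initial_state_def)
next
  case (Suc i) then show ?case using assms
    by (simp add: run_state_def is_program_def sequel_state)
qed

lemma finite_TC: "finite (TC x)"
proof (induction x)
  case (Atom x)
  have "y = Atom x" if "y \<in> TC (Atom x)" for y using that by induction auto
  then have "TC (Atom x) \<subseteq> {Atom x}" by blast
  then show ?case by (rule finite_subset) simp
next
  case (HSet s)
  have "y = HSet s \<or> (\<exists>z\<in>fset s. y \<in> TC z)" if "y \<in> TC (HSet s)" for y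
    using that by induction (auto intro: TC.intros)
  then have "TC (HSet s) \<subseteq> insert (HSet s) (\<Union>z\<in>fset s. TC z)" by blast
  then show ?case by (rule finite_subset) (use HSet in auto)
qed

lemma finite_active:
  assumes st: "is_state \<Upsilon> D A"
  shows "finite (active A)"
proof -
  let ?F = "{f. dyn_valid D f}"
  let ?E = "\<Union>f \<in> ?F. extent A f"
  have "f \<in> {Halt, Output} \<union> Aux ` {..<length D}" if "dyn_valid D f" for f
    using that by (cases f) auto
  then have "?F \<subseteq> {Halt, Output} \<union> Aux ` {..<length D}" by blast
  then have "finite ?F" by (rule finite_subset) simp
  then have fE: "finite ?E" using st by (auto simp: is_state_def)
  have E: "(xs, dyn A f xs) \<in> ?E" if "dyn A f xs \<noteq> ff" for f xs
    using st that by (fastforce simp: is_state_def extent_def)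
  have "critical A \<subseteq> Atom ` universe (input A) \<union> {ff, tt} \<union> snd ` ?E \<union> (\<Union>e \<in> ?E. set (fst e))"
  proof
    fix x assume "x \<in> critical A"
    then consider "x \<in> Atom ` universe (input A) \<union> {ff, tt}"
      | f xs where "x = dyn A f xs" "dyn A f xs \<noteq> ff"
      | f xs where "x \<in> set xs" "dyn A f xs \<noteq> ff"
      unfolding critical_def by blast
    then show "x \<in> Atom ` universe (input A) \<union> {ff, tt} \<union> snd ` ?E \<union> (\<Union>e \<in> ?E. set (fst e))"
    proof cases
      case 1 then show ?thesis by blast
    next
      case 2
      have "snd (xs, dyn A f xs) \<in> snd ` ?E" by (rule imageI[OF E[OF 2(2)]])
      then show ?thesis using 2(1) by simp
    next
      case 3
      have "x \<in> set (fst (xs, dyn A f xs))" using 3(1) by simp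
      then have "x \<in> (\<Union>e \<in> ?E. set (fst e))" using E[OF 3(2)] by blast
      then show ?thesis by blast
    qed
  qed
  moreover have "finite (universe (input A))" using st by (auto simp: is_state_def is_struct_def)
  moreover have "finite (\<Union>e \<in> ?E. set (fst e))" by (rule finite_UN_I[OF fE]) simp
  ultimately have "finite (critical A)"
    using fE by (meson finite.simps finite_Un finite_imageI finite_subset)
  then show ?thesis by (simp add: active_def finite_TC)
qed


end

theory Submission
  imports Defs
begin

text \<open>
  The program generates in parallel all linear orders of \<open>U\<close> and simulates, for each of them, the
  machine that decides \<open>K\<^sub>0\<close> on the encoding of the corresponding ordered version of \<open>A\<^sub>0\<close>. No
  link between orders and computations is kept: a single dynamic constant holds the set of all
  current configurations, and in one step it is replaced by the set of all their successors.
  Positions on the tape need no numbers, as a tape is stored as two stacks of nested pairs, and the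
  input string is pushed onto one of them in reverse by a small agenda of nested loops over \<open>U\<close>.
  Only the generation of orders branches, so there are never more than \<open>|U|!\<close> configurations, each
  of which grows by a bounded amount per step. All configurations reach the same verdict, as \<open>K\<^sub>0\<close>
  is closed under isomorphism and the encoding determines an ordered structure up to isomorphism.
\<close>

section \<open>Terms\<close>

text \<open>A program cannot pick one element of a set, since it treats indistinguishable elements
  alike. Once a configuration carries its own linear order, each of its sets has a definable
  greatest element, so every later choice is deterministic. The hypothesis on \<open>|A|\<close>
  pays for having one configuration per order: the \<open>|U|!\<close> configurations number at most
  \<open>|A|^j\<close>, and their sizes and the running time are polynomial in \<open>|U|\<close>.
  The space bound counts the objects active anywhere in the run, so the bound for a single state is
  multiplied by the number of states. No clock is built into the program: machines that halt early
  idle until all have halted, and the time bound of the machine enters only through the polynomials.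
  Correctness combines three facts about each configuration: it has a single successor once its
  order is complete, its size grows by at most a fixed amount, and a halting tag never changes.
  Together they are the relation \<open>det\<close>, whose powers describe whole
  computations.\<close>

abbreviation EqT :: "trm \<Rightarrow> trm \<Rightarrow> trm" where "EqT s t \<equiv> App Eq [s, t]"
abbreviation InT :: "trm \<Rightarrow> trm \<Rightarrow> trm" where "InT s t \<equiv> App InF [s, t]"
abbreviation AndT :: "trm \<Rightarrow> trm \<Rightarrow> trm" where "AndT s t \<equiv> App AndF [s, t]"
abbreviation OrT :: "trm \<Rightarrow> trm \<Rightarrow> trm" where "OrT s t \<equiv> App OrF [s, t]"
abbreviation NotT :: "trm \<Rightarrow> trm" where "NotT s \<equiv> App NotF [s]"
abbreviation TrueT :: trm where "TrueT \<equiv> App TrueF []"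
abbreviation EmptyT :: trm where "EmptyT \<equiv> App EmptyF []"
abbreviation PairT :: "trm \<Rightarrow> trm \<Rightarrow> trm" where "PairT s t \<equiv> App PairF [s, t]"
abbreviation BigUnT :: "trm \<Rightarrow> trm" where "BigUnT s \<equiv> App UnionF [s]"
abbreviation UnT :: "trm \<Rightarrow> trm \<Rightarrow> trm" where "UnT s t \<equiv> BigUnT (PairT s t)"
abbreviation TheT :: "trm \<Rightarrow> trm" where "TheT s \<equiv> App TheUniqueF [s]"

definition ExT :: "nat \<Rightarrow> trm \<Rightarrow> trm \<Rightarrow> trm" where
  "ExT v r g = NotT (EqT (Compr (Var v) v r g) EmptyT)"

definition KP :: "trm \<Rightarrow> trm \<Rightarrow> trm" where
  "KP s t = PairT (PairT s s) (PairT s t)"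

text \<open>Zermelo numerals: the successor is the singleton, so \<open>PairT\<close> builds it and
  \<open>TheT\<close> takes it off again. They serve as labels for tags, relation indices, depths
  and tape symbols.\<close>

fun NumT :: "nat \<Rightarrow> trm" where
  "NumT 0 = EmptyT"
| "NumT (Suc k) = PairT (NumT k) (NumT k)"

text \<open>The first component of a Kuratowski pair is the only \<open>x\<close> whose singleton
  belongs to the pair. Variables 10 and 11 are reserved for the projections, so that they can be
  nested and used next to variables 0, 1 and 2 without capture.\<close>

definition FstT :: "trm \<Rightarrow> trm" where
  "FstT t = TheT (Compr (Var 10) 10 (BigUnT t) (InT (PairT (Var 10) (Var 10)) t))"

definition SndT :: "trm \<Rightarrow> trm" where
  "SndT t = TheT (Compr (Var 10) 10 (BigUnT t)
     (ExT 11 (BigUnT t) (EqT t (KP (Var 11) (Var 10)))))"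

fun UnionsT :: "trm list \<Rightarrow> trm" where
  "UnionsT [] = EmptyT"
| "UnionsT (t # ts) = UnT t (UnionsT ts)"

lemma val_cong: "(\<And>v. v \<in> fv_trm t \<Longrightarrow> e v = e' v) \<Longrightarrow> val A e t = val A e' t"
proof (induction t arbitrary: e e')
  case (Var x) then show ?case by simp
next
  case (App f ts)
  have "val A e t = val A e' t" if "t \<in> set ts" for t
    by (rule App.IH[OF that]) (use App.prems that in auto)
  then have "map (val A e) ts = map (val A e') ts" by (intro map_cong refl)
  then show ?case by (simp only: val.simps)
next
  case (Compr t v r g)
  have r: "val A e r = val A e' r" using Compr.prems by (intro Compr.IH) auto
  have t: "val A (e(v := a)) t = val A (e'(v := a)) t" and
    g: "val A (e(v := a)) g = val A (e'(v := a)) g" for a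
    by (rule Compr.IH; use Compr.prems in auto)+
  show ?case by (simp only: val.simps r t g)
qed

lemma val_upd [simp]: "v \<notin> fv_trm t \<Longrightarrow> val A (e(v := a)) t = val A e t"
  by (rule val_cong) auto

definition tru :: "state \<Rightarrow> (nat \<Rightarrow> obj) \<Rightarrow> trm \<Rightarrow> bool" where
  "tru A e g \<longleftrightarrow> val A e g = tt"

section \<open>Pairs, projections and numerals as objects\<close>

definition singleton :: "obj \<Rightarrow> obj" where "singleton a = HSet {|a|}"
definition kp :: "obj \<Rightarrow> obj \<Rightarrow> obj" where "kp a b = HSet {|HSet {|a|}, HSet {|a, b|}|}"
definition big_union :: "obj \<Rightarrow> obj" where "big_union x = HSet (ffUnion (elems |`| elems x))"
definition the_elem_obj :: "obj \<Rightarrow> obj" where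
  "the_elem_obj x = (if \<exists>z. elems x = {|z|} then THE z. elems x = {|z|} else ff)"
definition ofst :: "obj \<Rightarrow> obj" where
  "ofst p = the_elem_obj (HSet (ffilter (\<lambda>a. singleton a |\<in>| elems p) (elems (big_union p))))"
definition osnd :: "obj \<Rightarrow> obj" where
  "osnd p = the_elem_obj (HSet (ffilter (\<lambda>b. \<exists>a. a |\<in>| elems (big_union p) \<and> p = kp a b) (elems (big_union p))))"

fun num :: "nat \<Rightarrow> obj" where
  "num 0 = ff"
| "num (Suc k) = singleton (num k)"

lemma ff_neq_tt [simp]: "ff \<noteq> tt" "tt \<noteq> ff" by (auto simp: ff_def tt_def)
lemma bool_obj_tt [simp]: "bool_obj b = tt \<longleftrightarrow> b" by (auto simp: bool_obj_def)
lemma elems_ff [simp]: "elems ff = {||}" by (simp add: ff_def)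

lemma elems_big_union [simp]: "a |\<in>| elems (big_union x) \<longleftrightarrow> (\<exists>y. y |\<in>| elems x \<and> a |\<in>| elems y)"
  by (auto simp: big_union_def ffUnion.rep_eq)

lemma the_elem_obj_singleton [simp]: "elems x = {|z|} \<Longrightarrow> the_elem_obj x = z"
  by (auto simp: the_elem_obj_def)

lemma kp_inj [simp]: "kp a b = kp c d \<longleftrightarrow> a = c \<and> b = d"
proof
  assume "kp a b = kp c d"
  then have "{{a}, {a, b}} = {{c}, {c, d}}"
    unfolding kp_def by (metis (no_types, lifting) elems.simps(2) finsert.rep_eq bot_fset.rep_eq
        image_empty image_insert)
  then show "a = c \<and> b = d" by (auto simp: doubleton_eq_iff)
qed simp

lemma kp_neq_ff [simp]: "kp a b \<noteq> ff" "ff \<noteq> kp a b" by (auto simp: kp_def ff_def)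

lemma elems_big_union_kp [simp]: "x |\<in>| elems (big_union (kp a b)) \<longleftrightarrow> x = a \<or> x = b"
  by (auto simp: kp_def)

lemma ofst_kp [simp]: "ofst (kp a b) = a"
  unfolding ofst_def
proof (rule the_elem_obj_singleton, rule fset_eqI)
  fix x
  have "singleton a |\<in>| elems (kp a b)" by (simp add: kp_def singleton_def)
  moreover have "b = a" if "singleton b |\<in>| elems (kp a b)"
    using that by (auto simp: kp_def singleton_def)
  ultimately show "x |\<in>| elems (HSet (ffilter (\<lambda>x. singleton x |\<in>| elems (kp a b)) (elems (big_union (kp a b)))))
      \<longleftrightarrow> x |\<in>| {|a|}"
    by (simp only: elems.simps ffmember_filter elems_big_union_kp fsingleton_iff) blast
qed

lemma osnd_kp [simp]: "osnd (kp a b) = b"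
  unfolding osnd_def by (rule the_elem_obj_singleton) (auto simp del: elems_big_union)

text \<open>The empty set is also the empty list and the numeral 0. Hence reading or popping an
  empty stack yields a blank or an empty stack, and the rules need no case distinction for
  it.\<close>

lemma ofst_ff [simp]: "ofst ff = ff" and osnd_ff [simp]: "osnd ff = ff"
  by (auto simp add: ofst_def osnd_def the_elem_obj_def big_union_def)

lemma num_inj [simp]: "num k = num l \<longleftrightarrow> k = l"
proof (induction k arbitrary: l)
  case 0 then show ?case by (cases l) (auto simp: singleton_def ff_def)
next
  case (Suc k) then show ?case by (cases l) (auto simp: singleton_def ff_def)
qed

lemma num_eq_ff [simp]: "num k = ff \<longleftrightarrow> k = 0" "ff = num k \<longleftrightarrow> k = 0"
  using num_inj[of k 0] by auto

lemma the_elem_obj_num [simp]: "the_elem_obj (num k) = num (k - 1)"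
  by (cases k) (auto simp: the_elem_obj_def singleton_def)

lemma val_PairT [simp]: "val A e (PairT s t) = HSet {|val A e s, val A e t|}"
  and val_EmptyT [simp]: "val A e EmptyT = ff"
  and val_BigUnT [simp]: "val A e (BigUnT t) = big_union (val A e t)"
  and val_TheT [simp]: "val A e (TheT t) = the_elem_obj (val A e t)"
  by (simp_all add: interp_def big_union_def the_elem_obj_def ff_def)

lemma tru_simps [simp]:
  "tru A e (EqT s t) \<longleftrightarrow> val A e s = val A e t"
  "tru A e (InT s t) \<longleftrightarrow> val A e s |\<in>| elems (val A e t)"
  "tru A e (AndT g h) \<longleftrightarrow> tru A e g \<and> tru A e h"
  "tru A e TrueT" "\<not> tru A e (App FalseF [])"
  by (auto simp: tru_def interp_def is_bool_def Let_def)

text \<open>A connective gives false on non-Boolean arguments, so \<open>NotT\<close> really negates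
  only terms known to be Boolean. This criterion guarantees it for every record of type
  \<open>state\<close>; dynamic names are left out because their values need not be Boolean in such
  a record.\<close>

fun static :: "trm \<Rightarrow> bool" where
  "static (App f ts) = ((\<exists>i. f = Inp i) \<or> f \<in> {Eq, TrueF, FalseF, NotF, AndF, OrF, InF})"
| "static _ = False"

lemma static_bool: "static g \<Longrightarrow> is_bool (val A e g)"
  by (cases g) (auto simp: interp_def Let_def)

lemma tru_NotT [simp]: "static g \<Longrightarrow> tru A e (NotT g) \<longleftrightarrow> \<not> tru A e g"
  using static_bool[of g A e] by (auto simp: tru_def interp_def)

lemma tru_OrT [simp]: "static g \<Longrightarrow> static h \<Longrightarrow> tru A e (OrT g h) \<longleftrightarrow> tru A e g \<or> tru A e h"
  using static_bool[of g A e] static_bool[of h A e] by (auto simp: tru_def interp_def)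

lemma val_Compr [simp]:
  "a |\<in>| elems (val A e (Compr t v r g)) \<longleftrightarrow>
     (\<exists>b. b |\<in>| elems (val A e r) \<and> tru A (e(v := b)) g \<and> a = val A (e(v := b)) t)"
  by (auto simp: tru_def)

declare val.simps(2,3) [simp del]

lemma static_ExT [simp]: "static (ExT v r g)" by (simp add: ExT_def)

lemma tru_ExT [simp]:
  "tru A e (ExT v r g) \<longleftrightarrow> (\<exists>a. a |\<in>| elems (val A e r) \<and> tru A (e(v := a)) g)"
proof -
  have "tru A e (ExT v r g) \<longleftrightarrow> val A e (Compr (Var v) v r g) \<noteq> ff"
    by (simp add: ExT_def)
  also have "\<dots> \<longleftrightarrow> (\<exists>a. a |\<in>| elems (val A e (Compr (Var v) v r g)))"
    by (subst (1 2) val.simps(3)) (auto simp: ff_def)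
  finally show ?thesis by simp
qed

lemma val_KP [simp]: "val A e (KP s t) = kp (val A e s) (val A e t)"
  by (simp add: KP_def kp_def)

lemma val_NumT [simp]: "val A e (NumT k) = num k"
  by (induction k) (auto simp: singleton_def)

lemma fv_macros [simp]:
  "fv_trm (ExT v r g) = fv_trm r \<union> (fv_trm g - {v})"
  "fv_trm (KP s t) = fv_trm s \<union> fv_trm t"
  "fv_trm (NumT k) = {}"
  "fv_trm (FstT t) = fv_trm t"
  "fv_trm (SndT t) = fv_trm t"
  "fv_trm (UnionsT ts) = (\<Union>t \<in> set ts. fv_trm t)"
proof -
  show 1: "fv_trm (ExT v r g) = fv_trm r \<union> (fv_trm g - {v})" for v r g
    by (auto simp: ExT_def)
  show 2: "fv_trm (KP s t) = fv_trm s \<union> fv_trm t" for s t by (auto simp: KP_def)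
  show "fv_trm (NumT k) = {}" by (induction k) auto
  show "fv_trm (FstT t) = fv_trm t" by (auto simp: FstT_def)
  show "fv_trm (SndT t) = fv_trm t" by (auto simp: SndT_def 1 2)
  show "fv_trm (UnionsT ts) = (\<Union>t \<in> set ts. fv_trm t)" by (induction ts) auto
qed

lemma val_FstT [simp]: "10 \<notin> fv_trm t \<Longrightarrow> val A e (FstT t) = ofst (val A e t)"
  by (simp add: FstT_def ofst_def val.simps(3) singleton_def flip: tru_def)

lemma val_SndT [simp]: "10 \<notin> fv_trm t \<Longrightarrow> 11 \<notin> fv_trm t \<Longrightarrow> val A e (SndT t) = osnd (val A e t)"
  by (simp add: SndT_def osnd_def val.simps(3) flip: tru_def)

lemma val_UnionsT [simp]:
  "a |\<in>| elems (val A e (UnionsT ts)) \<longleftrightarrow> (\<exists>t \<in> set ts. a |\<in>| elems (val A e t))"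
  by (induction ts) auto

lemma wf_macros [simp]:
  "wf_trm \<Upsilon> D (ExT v r g) \<longleftrightarrow>
     wf_trm \<Upsilon> D r \<and> wf_trm \<Upsilon> D g \<and> v \<notin> fv_trm r \<and> bool_trm D g"
  "wf_trm \<Upsilon> D (KP s t) \<longleftrightarrow> wf_trm \<Upsilon> D s \<and> wf_trm \<Upsilon> D t"
  "wf_trm \<Upsilon> D (NumT k)"
  "10 \<notin> fv_trm t \<Longrightarrow> wf_trm \<Upsilon> D (FstT t) \<longleftrightarrow> wf_trm \<Upsilon> D t"
  "10 \<notin> fv_trm t \<Longrightarrow> 11 \<notin> fv_trm t \<Longrightarrow> wf_trm \<Upsilon> D (SndT t) \<longleftrightarrow> wf_trm \<Upsilon> D t"
  "wf_trm \<Upsilon> D (UnionsT ts) \<longleftrightarrow> (\<forall>t \<in> set ts. wf_trm \<Upsilon> D t)"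
proof -
  note [simp] = valid_def arity_def relational_def
  show 1: "wf_trm \<Upsilon> D (ExT v r g) \<longleftrightarrow>
     wf_trm \<Upsilon> D r \<and> wf_trm \<Upsilon> D g \<and> v \<notin> fv_trm r \<and> bool_trm D g" for v r g
    by (auto simp: ExT_def)
  show 2: "wf_trm \<Upsilon> D (KP s t) \<longleftrightarrow> wf_trm \<Upsilon> D s \<and> wf_trm \<Upsilon> D t" for s t
    by (auto simp: KP_def)
  show "wf_trm \<Upsilon> D (NumT k)" by (induction k) auto
  show "10 \<notin> fv_trm t \<Longrightarrow> wf_trm \<Upsilon> D (FstT t) \<longleftrightarrow> wf_trm \<Upsilon> D t" by (auto simp: FstT_def)
  show "10 \<notin> fv_trm t \<Longrightarrow> 11 \<notin> fv_trm t \<Longrightarrow> wf_trm \<Upsilon> D (SndT t) \<longleftrightarrow> wf_trm \<Upsilon> D t"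
    by (auto simp: SndT_def 1 2) (auto simp: ExT_def)
  show "wf_trm \<Upsilon> D (UnionsT ts) \<longleftrightarrow> (\<forall>t \<in> set ts. wf_trm \<Upsilon> D t)" by (induction ts) auto
qed

lemma bool_ExT [simp]: "bool_trm D (ExT v r g)" by (simp add: ExT_def relational_def)

declare NumT.simps [simp del] num.simps [simp del]

section \<open>Configurations\<close>

text \<open>
  A frame \<open>(i, d, args, s)\<close> on the agenda asks for the part of the bit string of relation \<open>i\<close> whose
  tuples begin with \<open>rev args\<close>, then an element of \<open>s\<close>, then \<open>d - 1\<close> further elements.
\<close>

type_synonym frame = "nat \<times> nat \<times> nat list \<times> nat fset"

text \<open>
  A configuration consists of a tag, a reflexive linear order, an agenda, and the two halves of a
  tape. Tag \<open>0\<close> means that the order is being generated, tag \<open>1\<close> that the encoding is being written,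
  and tag \<open>q + 2\<close> that the machine is in state \<open>q\<close>.
\<close>

type_synonym conf = "nat \<times> (nat \<times> nat) fset \<times> frame list \<times> nat list \<times> nat list"

fun list_obj :: "obj list \<Rightarrow> obj" where
  "list_obj [] = ff"
| "list_obj (x # xs) = kp x (list_obj xs)"

definition atoms :: "nat fset \<Rightarrow> obj" where "atoms s = HSet (Atom |`| s)"

definition order_obj :: "(nat \<times> nat) fset \<Rightarrow> obj" where
  "order_obj r = HSet ((\<lambda>(x, y). kp (Atom x) (Atom y)) |`| r)"

fun frame_obj :: "frame \<Rightarrow> obj" where
  "frame_obj (i, d, args, s) = kp (num i) (kp (num d) (kp (list_obj (map Atom args)) (atoms s)))"

fun conf_obj :: "conf \<Rightarrow> obj" where
  "conf_obj (q, r, ag, ls, rs) = kp (num q) (kp (order_obj r) (kp (list_obj (map frame_obj ag))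
     (kp (list_obj (map num ls)) (list_obj (map num rs)))))"

text \<open>The symbol under the head; beyond its end, a tape half is blank.\<close>

definition head_symbol :: "nat list \<Rightarrow> nat" where "head_symbol xs = (if xs = [] then 0 else hd xs)"

lemma head_symbol_simps [simp]: "head_symbol [] = 0" "head_symbol (x # xs) = x" by (simp_all add: head_symbol_def)

lemma ofst_list_num [simp]: "ofst (list_obj (map num xs)) = num (head_symbol xs)"
  and osnd_list_map [simp]: "osnd (list_obj (map f ys)) = list_obj (map f (tl ys))"
  by (cases xs; simp) (cases ys; simp)

lemma list_obj_eq_ff [simp]: "list_obj xs = ff \<longleftrightarrow> xs = []"
  by (cases xs) auto

lemma map_Atom_in [simp]: "map Atom xs \<in> map Atom ` R \<longleftrightarrow> xs \<in> R"
  by (rule inj_image_mem_iff) (simp add: inj_def)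

lemma kp_in_order_obj [simp]: "kp (Atom x) (Atom y) |\<in>| elems (order_obj r) \<longleftrightarrow> (x, y) |\<in>| r"
  by (force simp: order_obj_def)

lemma elems_atoms: "a |\<in>| elems (atoms s) \<longleftrightarrow> (\<exists>x. x |\<in>| s \<and> a = Atom x)"
  by (auto simp: atoms_def)

lemma ex_elems_atoms [simp]:
  "(\<exists>a. a |\<in>| elems (atoms s) \<and> P a) \<longleftrightarrow> (\<exists>x. x |\<in>| s \<and> P (Atom x))"
  by (auto simp: elems_atoms)

lemma atoms_eq_ff [simp]: "atoms s = ff \<longleftrightarrow> s = {||}"
  by (auto simp: atoms_def ff_def)

definition tagT :: trm where "tagT = FstT (Var 0)"
definition orderT :: trm where "orderT = FstT (SndT (Var 0))"
definition agendaT :: trm where "agendaT = FstT (SndT (SndT (Var 0)))"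
definition leftT :: trm where "leftT = FstT (SndT (SndT (SndT (Var 0))))"
definition rightT :: trm where "rightT = SndT (SndT (SndT (SndT (Var 0))))"
definition indexT :: trm where "indexT = FstT (FstT agendaT)"
definition depthT :: trm where "depthT = FstT (SndT (FstT agendaT))"
definition argsT :: trm where "argsT = FstT (SndT (SndT (FstT agendaT)))"
definition restT :: trm where "restT = SndT (SndT (SndT (FstT agendaT)))"

lemmas projT_defs = tagT_def orderT_def agendaT_def leftT_def rightT_def indexT_def depthT_def
  argsT_def restT_def

lemma fv_projT [simp]:
  "fv_trm tagT = {0}" "fv_trm orderT = {0}" "fv_trm agendaT = {0}" "fv_trm leftT = {0}"
  "fv_trm rightT = {0}" "fv_trm indexT = {0}" "fv_trm depthT = {0}" "fv_trm argsT = {0}"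
  "fv_trm restT = {0}"
  by (simp_all add: projT_defs)

lemma wf_projT [simp]:
  "wf_trm \<Upsilon> D tagT" "wf_trm \<Upsilon> D orderT" "wf_trm \<Upsilon> D agendaT" "wf_trm \<Upsilon> D leftT"
  "wf_trm \<Upsilon> D rightT" "wf_trm \<Upsilon> D indexT" "wf_trm \<Upsilon> D depthT" "wf_trm \<Upsilon> D argsT"
  "wf_trm \<Upsilon> D restT"
  by (simp_all add: projT_defs)

lemma val_projT [simp]:
  "val A e tagT = ofst (e 0)" "val A e orderT = ofst (osnd (e 0))"
  "val A e agendaT = ofst (osnd (osnd (e 0)))" "val A e leftT = ofst (osnd (osnd (osnd (e 0))))"
  "val A e rightT = osnd (osnd (osnd (osnd (e 0))))"
  "val A e indexT = ofst (ofst (ofst (osnd (osnd (e 0)))))"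
  "val A e depthT = ofst (osnd (ofst (ofst (osnd (osnd (e 0))))))"
  "val A e argsT = ofst (osnd (osnd (ofst (ofst (osnd (osnd (e 0)))))))"
  "val A e restT = osnd (osnd (osnd (ofst (ofst (osnd (osnd (e 0)))))))"
  by (simp_all add: projT_defs)

definition confT :: "trm \<Rightarrow> trm \<Rightarrow> trm \<Rightarrow> trm \<Rightarrow> trm \<Rightarrow> trm" where
  "confT q r ag ls rs = KP q (KP r (KP ag (KP ls rs)))"

definition frameT :: "trm \<Rightarrow> trm \<Rightarrow> trm \<Rightarrow> trm \<Rightarrow> trm" where
  "frameT i d args s = KP i (KP d (KP args s))"

lemma fv_confT [simp]:
  "fv_trm (confT q r ag ls rs) = fv_trm q \<union> fv_trm r \<union> fv_trm ag \<union> fv_trm ls \<union> fv_trm rs"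
  "fv_trm (frameT i d args s) = fv_trm i \<union> fv_trm d \<union> fv_trm args \<union> fv_trm s"
  by (auto simp: confT_def frameT_def)

lemma wf_confT [simp]:
  "wf_trm \<Upsilon> D (confT q r ag ls rs) \<longleftrightarrow> wf_trm \<Upsilon> D q \<and> wf_trm \<Upsilon> D r \<and> wf_trm \<Upsilon> D ag \<and>
     wf_trm \<Upsilon> D ls \<and> wf_trm \<Upsilon> D rs"
  "wf_trm \<Upsilon> D (frameT i d args s) \<longleftrightarrow> wf_trm \<Upsilon> D i \<and> wf_trm \<Upsilon> D d \<and> wf_trm \<Upsilon> D args \<and>
     wf_trm \<Upsilon> D s"
  by (auto simp: confT_def frameT_def)


section \<open>The program\<close>

text \<open>
  A rule \<open>(r, g, t)\<close> leads from a configuration \<open>c\<close>, the value of variable \<open>0\<close>, to all \<open>t\<close> where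
  variable \<open>1\<close> ranges over those elements of \<open>r\<close> that satisfy \<open>g\<close>.
\<close>

type_synonym step_rule = "trm \<times> trm \<times> trm"

locale order_simulation =
  fixes \<Upsilon> :: vocabulary and M :: tm
begin

definition uT :: trm where
  "uT = Compr (Var 2) 2 (App AtomsF []) (App (Inp (length \<Upsilon>)) [Var 2])"

abbreviation oneT :: trm where "oneT \<equiv> PairT EmptyT EmptyT"

text \<open>An element counts as placed if it is related to itself, which is why the order is kept
  reflexive. The new element becomes the greatest: it goes above itself and all placed
  elements.\<close>

definition extend_rule :: step_rule where
  "extend_rule = (uT, AndT (EqT tagT (NumT 0)) (NotT (InT (KP (Var 1) (Var 1)) orderT)),
     confT (NumT 0)
      (UnT orderT (Compr (KP (Var 2) (Var 1)) 2 uT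
         (OrT (InT (KP (Var 2) (Var 2)) orderT) (EqT (Var 2) (Var 1)))))
      agendaT leftT rightT)"

text \<open>A rule that does not branch lets variable 1 range over the one-element set
  \<open>oneT\<close>, so that it has at most one result.\<close>

definition ordered_rule :: step_rule where
  "ordered_rule = (oneT,
     AndT (EqT tagT (NumT 0)) (NotT (ExT 2 uT (NotT (InT (KP (Var 2) (Var 2)) orderT)))),
     confT (NumT 1) orderT agendaT leftT rightT)"

definition pop_rule :: step_rule where
  "pop_rule = (oneT,
     AndT (EqT tagT (NumT 1)) (AndT (NotT (EqT depthT EmptyT)) (EqT restT EmptyT)),
     confT (NumT 1) orderT (SndT agendaT) leftT rightT)"

text \<open>The greatest remaining element is taken first, so the tuples come in reverse
  lexicographic order. As each bit is pushed on the front of the right half, the string finally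
  stands in the proper order.\<close>

definition loop_rule :: step_rule where
  "loop_rule = (restT,
     AndT (EqT tagT (NumT 1)) (AndT (NotT (EqT depthT EmptyT))
       (NotT (ExT 2 restT (AndT (InT (KP (Var 1) (Var 2)) orderT) (NotT (EqT (Var 1) (Var 2))))))),
     confT (NumT 1) orderT
      (KP (frameT indexT (TheT depthT) (KP (Var 1) argsT) uT)
        (KP (frameT indexT depthT argsT (Compr (Var 2) 2 restT (NotT (EqT (Var 2) (Var 1)))))
          (SndT agendaT)))
      leftT rightT)"

definition start_rule :: step_rule where
  "start_rule = (oneT, AndT (EqT tagT (NumT 1)) (EqT agendaT EmptyT),
     confT (NumT 2) orderT agendaT leftT rightT)"

text \<open>The stack \<open>args\<close> has the most recent component on top, hence the
  reversal.\<close>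

definition tupleT :: "nat \<Rightarrow> trm list" where
  "tupleT r = map (\<lambda>j. FstT ((SndT ^^ j) argsT)) (rev [0..<r])"

text \<open>
  The encoding is the concatenation of the bit strings of the relations of the structure, preceded
  by those of the full unary and of the empty nullary relation, which are \<open>1\<^sup>n\<close> and \<open>0\<close>.
\<close>

definition arity_list :: "nat list" where "arity_list = [1, 0] @ \<Upsilon> @ [2]"

definition bitTs :: "trm list" where
  "bitTs = [TrueT, App FalseF []] @ map (\<lambda>k. App (Inp k) (tupleT (\<Upsilon> ! k))) [0..<length \<Upsilon>] @
     [AndT (InT (KP (tupleT 2 ! 0) (tupleT 2 ! 1)) orderT) (NotT (EqT (tupleT 2 ! 0) (tupleT 2 ! 1)))]"

text \<open>The agenda must be tested for emptiness: projected from an empty agenda, index and depth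
  are both 0, which looks like a finished tuple of relation 0. The symbols 2 and 1 are the input
  bits of the machine.\<close>

definition bit_rule :: "nat \<Rightarrow> bool \<Rightarrow> step_rule" where
  "bit_rule i b = (oneT,
     AndT (AndT (EqT tagT (NumT 1)) (NotT (EqT agendaT EmptyT)))
       (AndT (AndT (EqT indexT (NumT i)) (EqT depthT EmptyT))
         (if b then bitTs ! i else NotT (bitTs ! i))),
     confT (NumT 1) orderT (SndT agendaT) leftT (KP (NumT (if b then 2 else 1)) rightT))"

definition tm_rule :: "nat \<Rightarrow> nat \<Rightarrow> step_rule" where
  "tm_rule q a = (case tm_delta M q a of (q', a', d) \<Rightarrow> (oneT,
     AndT (EqT tagT (NumT (q + 2))) (EqT (FstT rightT) (NumT a)),
     confT (NumT (q' + 2)) orderT agendaT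
      (if d = 1 then KP (NumT a') leftT else if d = 0 then leftT else SndT leftT)
      (if d = 1 then SndT rightT else if d = 0 then KP (NumT a') (SndT rightT)
       else KP (FstT leftT) (KP (NumT a') (SndT rightT)))))"

text \<open>Computations for different orders may halt at different times; a halted one has to
  survive until the last one halts.\<close>

definition idle_rule :: "nat \<Rightarrow> step_rule" where
  "idle_rule q = (oneT, EqT tagT (NumT (q + 2)), Var 0)"

definition rules :: "step_rule list" where
  "rules = [extend_rule, ordered_rule, pop_rule, loop_rule, start_rule] @
     concat (map (\<lambda>i. [bit_rule i True, bit_rule i False]) [0..<length arity_list]) @
     [tm_rule q a. q \<leftarrow> [0..<tm_states M], q \<noteq> tm_accept M \<and> q \<noteq> tm_reject M,
        a \<leftarrow> [0..<tm_symbols M]] @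
     [idle_rule (tm_accept M), idle_rule (tm_reject M)]"

text \<open>With \<open>fires\<close> in place of \<open>P\<close> this lists the possible
  successors of a configuration; with the negation of \<open>rule_ok\<close> it reduces
  well-formedness to the single rules.\<close>

lemma Bex_rules:
  "(\<exists>\<rho> \<in> set rules. P \<rho>) \<longleftrightarrow>
     P extend_rule \<or> P ordered_rule \<or> P pop_rule \<or> P loop_rule \<or> P start_rule \<or>
     (\<exists>i < length arity_list. \<exists>b. P (bit_rule i b)) \<or>
     (\<exists>p < tm_states M. p \<noteq> tm_accept M \<and> p \<noteq> tm_reject M \<and>
        (\<exists>a < tm_symbols M. P (tm_rule p a))) \<or>
     P (idle_rule (tm_accept M)) \<or> P (idle_rule (tm_reject M))"
  by (simp add: rules_def bex_Un ex_bool_eq) (auto 0 3 simp: Bex_def)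

abbreviation env :: "obj \<Rightarrow> obj \<Rightarrow> nat \<Rightarrow> obj" where
  "env c x \<equiv> (\<lambda>_. ff)(0 := c, 1 := x)"

definition fires :: "state \<Rightarrow> step_rule \<Rightarrow> obj \<Rightarrow> obj \<Rightarrow> bool" where
  "fires A \<rho> c c' \<longleftrightarrow> (case \<rho> of (r, g, t) \<Rightarrow>
     \<exists>x. x |\<in>| elems (val A ((\<lambda>_. ff)(0 := c)) r) \<and> tru A (env c x) g \<and> c' = val A (env c x) t)"

definition next_objs :: "state \<Rightarrow> obj \<Rightarrow> obj set" where
  "next_objs A c = {c'. \<exists>\<rho> \<in> set rules. fires A \<rho> c c'}"

end

section \<open>The input structure and its set \<open>U\<close>\<close>

locale order_simulation_on = order_simulation +
  fixes S :: fin_struct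
  assumes struct: "is_struct (\<Upsilon> @ [1]) S" and tm: "is_tm M"
begin

definition U :: "nat fset" where "U = Abs_fset (U_set \<Upsilon> S)"

lemma U_set_subset: "U_set \<Upsilon> S \<subseteq> universe S"
  using struct by (auto simp: U_set_def is_struct_def list_all2_conv_all_nth)
    (metis (no_types, lifting) in_mono length_append_singleton lessI list.set_intros(1)
      mem_Collect_eq nth_append_length)

lemma fset_U [simp]: "fset U = U_set \<Upsilon> S"
  using U_set_subset struct by (auto simp: U_def is_struct_def Abs_fset_inverse finite_subset)

lemma fmember_U: "x |\<in>| U \<longleftrightarrow> x \<in> U_set \<Upsilon> S"
  by simp

context
  fixes A :: state
  assumes input: "input A = S"
begin

lemma val_AtomsF: "val A e (App AtomsF []) = atoms (Abs_fset (universe S))"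
  using struct input
  by (simp add: val.simps interp_def atoms_def is_struct_def Abs_fset_inverse fimage_def)

lemma tru_Inp: "tru A e (App (Inp k) ts) \<longleftrightarrow> map (val A e) ts \<in> map Atom ` (rels S ! k)"
  using input by (simp add: tru_def val.simps interp_def)

lemma val_uT [simp]: "val A e uT = atoms U"
proof -
  have "a |\<in>| elems (val A e uT) \<longleftrightarrow> a |\<in>| elems (atoms U)" for a
    using U_set_subset struct map_Atom_in[of "[_]"]
    by (auto simp: elems_atoms uT_def val_AtomsF tru_Inp is_struct_def Abs_fset_inverse U_set_def fmember_U)
  moreover have "\<exists>s. val A e uT = HSet s" by (simp add: uT_def val.simps(3))
  ultimately show ?thesis unfolding atoms_def by (metis elems.simps(2) fset_eqI)
qed

end
end

lemma union_pair_order: "big_union (HSet {|order_obj r, order_obj r'|}) = order_obj (r |\<union>| r')"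
  by (auto simp: big_union_def order_obj_def ffUnion.rep_eq simp flip: fset_inject)

lemma elems_order_obj:
  "a |\<in>| elems (order_obj r) \<longleftrightarrow> (\<exists>x y. (x, y) |\<in>| r \<and> a = kp (Atom x) (Atom y))"
  by (auto simp: order_obj_def)

lemma HSet_eqI: "(\<And>a. a |\<in>| elems x \<longleftrightarrow> a |\<in>| elems y) \<Longrightarrow> \<exists>s. x = HSet s \<Longrightarrow> \<exists>s. y = HSet s \<Longrightarrow> x = y"
  by (auto simp: fset_eq_iff)

lemma val_minus:
  assumes "val A e r = atoms s" "e (Suc 0) = Atom x" "2 \<notin> fv_trm r"
  shows "val A e (Compr (Var 2) 2 r (NotT (EqT (Var 2) (Var 1)))) = atoms (s |-| {|x|})"
proof (rule HSet_eqI)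
  show "a |\<in>| elems (val A e (Compr (Var 2) 2 r (NotT (EqT (Var 2) (Var 1))))) \<longleftrightarrow>
    a |\<in>| elems (atoms (s |-| {|x|}))" for a
    by (simp add: assms elems_atoms) (auto simp: assms)
qed (auto simp: val.simps(3) atoms_def)

lemma val_nth_arg:
  assumes "fv_trm t = {0}" "val A e t = list_obj (map Atom args)" "j < length args"
  shows "val A e (FstT ((SndT ^^ j) t)) = Atom (args ! j)"
proof -
  have fv: "fv_trm ((SndT ^^ j) t) = {0}" for j by (induction j) (simp_all add: assms(1))
  have "val A e ((SndT ^^ j) t) = list_obj (map Atom (drop j args))" for j
    by (induction j) (simp_all add: assms(2) fv drop_Suc tl_drop)
  then show ?thesis using assms(3) by (simp add: fv Cons_nth_drop_Suc[symmetric])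
qed

section \<open>Effect of each step rule on a configuration\<close>

context order_simulation_on
begin

lemma val_extend:
  assumes input: "input A = S"
    and "ofst (osnd (e 0)) = order_obj r" "e (Suc 0) = Atom x"
  shows "val A e (Compr (KP (Var 2) (Var 1)) 2 uT
      (OrT (InT (KP (Var 2) (Var 2)) orderT) (EqT (Var 2) (Var 1)))) =
    order_obj ((\<lambda>y. (y, x)) |`| ffilter (\<lambda>y. (y, y) |\<in>| r \<or> y = x) U)"
proof (rule HSet_eqI)
  show "a |\<in>| elems (val A e (Compr (KP (Var 2) (Var 1)) 2 uT
      (OrT (InT (KP (Var 2) (Var 2)) orderT) (EqT (Var 2) (Var 1))))) \<longleftrightarrow>
    a |\<in>| elems (order_obj ((\<lambda>y. (y, x)) |`| ffilter (\<lambda>y. (y, y) |\<in>| r \<or> y = x) U))" for a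
    by (simp add: assms val_uT[OF input] elems_order_obj del: fset_U)
      (auto simp del: fset_U)
qed (auto simp: val.simps(3) order_obj_def)

lemma fires_extend:
  assumes input: "input A = S"
  shows "fires A extend_rule (conf_obj (q, r, ag, ls, rs)) c' \<longleftrightarrow>
     q = 0 \<and> (\<exists>x. x |\<in>| U \<and> (x, x) |\<notin>| r \<and>
       c' = conf_obj (0, r |\<union>| (\<lambda>y. (y, x)) |`| ffilter (\<lambda>y. (y, y) |\<in>| r \<or> y = x) U, ag, ls, rs))"
  by (auto simp: fires_def extend_rule_def confT_def val_uT[OF input]
      val_extend[OF input, of _ r, unfolded One_nat_def] union_pair_order simp del: fset_U)

lemma fires_ordered:
  assumes input: "input A = S"
  shows "fires A ordered_rule (conf_obj (q, r, ag, ls, rs)) c' \<longleftrightarrow>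
     q = 0 \<and> (\<forall>x. x |\<in>| U \<longrightarrow> (x, x) |\<in>| r) \<and> c' = conf_obj (1, r, ag, ls, rs)"
  by (auto simp: fires_def ordered_rule_def confT_def val_uT[OF input] simp del: fset_U)

lemma fires_pop:
  "fires A pop_rule (conf_obj (q, r, ag, ls, rs)) c' \<longleftrightarrow>
     q = 1 \<and> (\<exists>i d args ag'. ag = (i, Suc d, args, {||}) # ag' \<and> c' = conf_obj (1, r, ag', ls, rs))"
proof (cases ag)
  case Nil
  then show ?thesis by (auto simp: fires_def pop_rule_def)
next
  case (Cons f ag')
  obtain i d args s where "f = (i, d, args, s)" by (cases f) auto
  with Cons show ?thesis
    by (cases d) (auto simp: fires_def pop_rule_def confT_def)
qed

lemma fires_start:
  "fires A start_rule (conf_obj (q, r, ag, ls, rs)) c' \<longleftrightarrow>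
     q = 1 \<and> ag = [] \<and> c' = conf_obj (2, r, [], ls, rs)"
  by (auto simp: fires_def start_rule_def confT_def)

lemma fires_loop:
  assumes input: "input A = S"
  shows "fires A loop_rule (conf_obj (q, r, ag, ls, rs)) c' \<longleftrightarrow>
     q = 1 \<and> (\<exists>i d args s ag' x. ag = (i, Suc d, args, s) # ag' \<and> x |\<in>| s \<and>
       (\<forall>y. y |\<in>| s \<and> (x, y) |\<in>| r \<longrightarrow> x = y) \<and>
       c' = conf_obj (1, r, (i, d, x # args, U) # (i, Suc d, args, s |-| {|x|}) # ag', ls, rs))"
proof (cases ag)
  case Nil
  then show ?thesis by (auto simp: fires_def loop_rule_def)
next
  case (Cons f ag')
  obtain i d args s where f: "f = (i, d, args, s)" by (cases f) auto
  show ?thesis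
    unfolding Cons f
    by (cases d) (auto simp: fires_def loop_rule_def confT_def frameT_def val_uT[OF input]
        val_minus[where s = s, unfolded One_nat_def])
qed

lemma fires_tm:
  assumes "tm_delta M q' a = (q'', a', d)"
  shows "fires A (tm_rule q' a) (conf_obj (q, r, ag, ls, rs)) c' \<longleftrightarrow>
    q = q' + 2 \<and> head_symbol rs = a \<and>
    c' = conf_obj (q'' + 2, r, ag,
      if d = 1 then a' # ls else if d = 0 then ls else tl ls,
      if d = 1 then tl rs else if d = 0 then a' # tl rs else head_symbol ls # a' # tl rs)"
  using assms by (auto simp: fires_def tm_rule_def confT_def)

lemma fires_idle:
  "fires A (idle_rule q') (conf_obj (q, r, ag, ls, rs)) c' \<longleftrightarrow>
     q = q' + 2 \<and> c' = conf_obj (q, r, ag, ls, rs)"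
  by (auto simp: fires_def idle_rule_def)

definition relations :: "(nat \<times> nat) fset \<Rightarrow> nat list set list" where
  "relations r = [UNIV, {}] @ take (length \<Upsilon>) (rels S) @ [{[x, y] | x y. (x, y) |\<in>| r \<and> x \<noteq> y}]"

lemma val_tupleT:
  assumes "e 0 = conf_obj (q, r, (i, d, args, s) # ag, ls, rs)" "length args = n"
  shows "map (val A e) (tupleT n) = map Atom (rev args)"
proof -
  have "map (\<lambda>j. val A e (FstT ((SndT ^^ j) argsT))) [0..<n] = map (\<lambda>j. Atom (args ! j)) [0..<n]"
    by (rule map_cong) (use assms val_nth_arg[of argsT A e args] in auto)
  also have "\<dots> = map Atom args"
    using assms(2) by (metis map_nth map_map[of Atom "\<lambda>j. args ! j", unfolded comp_def])
  finally show ?thesis by (simp add: tupleT_def flip: rev_map) (simp add: o_def)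
qed

lemma length_rels: "length (rels S) = Suc (length \<Upsilon>)"
  using struct by (simp add: is_struct_def list_all2_conv_all_nth)

lemma tru_bitTs:
  assumes input: "input A = S"
    and "e 0 = conf_obj (q, r, (i, d, args, s) # ag, ls, rs)" "i < length arity_list"
    "length args = arity_list ! i"
  shows "tru A e (bitTs ! i) \<longleftrightarrow> rev args \<in> relations r ! i"
proof -
  consider "i = 0" | "i = 1" | "2 \<le> i" "i < length \<Upsilon> + 2" | "i = length \<Upsilon> + 2"
    using assms(3) by (force simp: arity_list_def)
  then show ?thesis
  proof cases
    case 3
    then obtain k where k: "i = Suc (Suc k)" "k < length \<Upsilon>"
      by (metis One_nat_def Suc_1 add_2_eq_Suc' add_less_cancel_right le_iff_add add.commute)
    have a: "length args = \<Upsilon> ! k"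
      using k assms(4) by (simp add: arity_list_def nth_append)
    have "tru A e (bitTs ! i) \<longleftrightarrow> map Atom (rev args) \<in> map Atom ` (rels S ! k)"
      using k val_tupleT[of e q r i d args s ag ls rs, OF assms(2) a]
      by (simp add: bitTs_def nth_append tru_Inp[OF input])
    also have "\<dots> \<longleftrightarrow> rev args \<in> relations r ! i"
      using k length_rels by (simp only: map_Atom_in) (simp add: relations_def nth_append)
    finally show ?thesis .
  next
    case 4
    then have a: "length args = 2" using assms(4) by (simp add: arity_list_def nth_append)
    then obtain y x where args: "args = [y, x]" by (auto simp: length_Suc_conv numeral_2_eq_2)
    have t: "map (val A e) (tupleT 2) = [Atom x, Atom y]" using val_tupleT[of e q r i d args s ag ls rs, OF assms(2) a] args by simp
    have l: "length (tupleT 2) = 2" by (simp add: tupleT_def)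
    have "val A e (tupleT 2 ! 0) = Atom x" "val A e (tupleT 2 ! 1) = Atom y"
      using t l nth_map[of 0 "tupleT 2" "val A e"] nth_map[of 1 "tupleT 2" "val A e"] by auto
    then show ?thesis
      using 4 assms(2) args length_rels
      by (auto simp: bitTs_def relations_def nth_append simp del: One_nat_def)
  qed (auto simp: bitTs_def relations_def)
qed

lemma static_bitTs: "i < length arity_list \<Longrightarrow> static (bitTs ! i)"
  by (auto simp: arity_list_def bitTs_def nth_append nth_Cons split: nat.splits)

lemma fires_bit:
  assumes "i < length arity_list"
  shows "fires A (bit_rule i b) (conf_obj (q, r, ag, ls, rs)) c' \<longleftrightarrow>
    q = 1 \<and> (\<exists>args s ag'. ag = (i, 0, args, s) # ag' \<and>
      tru A (env (conf_obj (q, r, ag, ls, rs)) ff) (bitTs ! i) = b \<and>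
      c' = conf_obj (1, r, ag', ls, (if b then 2 else 1) # rs))"
proof (cases ag)
  case Nil
  then show ?thesis by (auto simp: fires_def bit_rule_def)
next
  case (Cons f ag')
  obtain i' d args s where "f = (i', d, args, s)" by (cases f) auto
  with Cons assms show ?thesis
    by (auto simp: fires_def bit_rule_def confT_def static_bitTs numeral_2_eq_2)
qed

end

section \<open>The size of objects\<close>

lemma TC_Atom: "TC (Atom x) = {Atom x}"
proof -
  have "y = Atom x" if "y \<in> TC (Atom x)" for y using that by induction auto
  then show ?thesis by (auto intro: TC.self)
qed

lemma TC_HSet: "TC (HSet s) \<subseteq> insert (HSet s) (\<Union>z \<in> fset s. TC z)"
proof
  fix y assume "y \<in> TC (HSet s)"
  then show "y \<in> insert (HSet s) (\<Union>z \<in> fset s. TC z)"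
    by induction (auto intro: TC.intros)
qed

lemma card_TC_HSet: "card (TC (HSet s)) \<le> 1 + (\<Sum>z \<in> fset s. card (TC z))"
proof -
  have "card (TC (HSet s)) \<le> card (insert (HSet s) (\<Union>z \<in> fset s. TC z))"
    by (rule card_mono[OF _ TC_HSet]) (simp add: finite_TC)
  also have "\<dots> \<le> 1 + card (\<Union>z \<in> fset s. TC z)"
    by (simp add: card_insert_if finite_TC)
  also have "\<dots> \<le> 1 + (\<Sum>z \<in> fset s. card (TC z))"
    by (simp add: card_UN_le)
  finally show ?thesis .
qed

text \<open>Outside the closures of the components there are only the pair itself and its two
  members.\<close>

lemma card_TC_kp: "card (TC (kp a b)) \<le> 3 + card (TC a) + card (TC b)"
proof -
  have "TC (kp a b) \<subseteq> {kp a b, HSet {|a|}, HSet {|a, b|}} \<union> (TC a \<union> TC b)"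
    using TC_HSet[of "{|a|}"] TC_HSet[of "{|a, b|}"] TC_HSet[of "{|HSet {|a|}, HSet {|a, b|}|}"]
    unfolding kp_def by auto
  then have "card (TC (kp a b)) \<le> card ({kp a b, HSet {|a|}, HSet {|a, b|}} \<union> (TC a \<union> TC b))"
    by (rule card_mono[rotated]) (simp add: finite_TC)
  also have "\<dots> \<le> card {kp a b, HSet {|a|}, HSet {|a, b|}} + (card (TC a) + card (TC b))"
    by (meson card_Un_le add_left_mono order_trans)
  also have "card {kp a b, HSet {|a|}, HSet {|a, b|}} \<le> 3"
    by (simp add: card_insert_if)
  finally show ?thesis by simp
qed

lemma card_TC_num: "card (TC (num k)) \<le> k + 1"
proof (induction k)
  case 0
  then show ?case using card_TC_HSet[of "{||}"] by (simp add: num.simps ff_def)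
next
  case (Suc k)
  then show ?case using card_TC_HSet[of "{|num k|}"] by (simp add: num.simps singleton_def)
qed

lemma card_TC_fimage:
  assumes "\<And>x. card (TC (f x)) \<le> n"
  shows "card (TC (HSet (f |`| s))) \<le> 1 + n * fcard s"
proof -
  have "(\<Sum>z \<in> fset (f |`| s). card (TC z)) \<le> n * card (fset (f |`| s))"
    using sum_bounded_above[of "fset (f |`| s)" "\<lambda>z. card (TC z)" n] assms
    by (auto simp: mult.commute)
  also have "\<dots> \<le> n * fcard s" by (simp add: fcard.rep_eq card_image_le)
  finally show ?thesis using card_TC_HSet[of "f |`| s"] by simp
qed

lemma card_TC_atoms: "card (TC (atoms s)) \<le> 1 + fcard s"
  using card_TC_fimage[of Atom 1 s] by (simp add: atoms_def TC_Atom)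

lemma card_TC_order_obj: "card (TC (order_obj r)) \<le> 1 + 5 * fcard r"
  unfolding order_obj_def
  by (rule card_TC_fimage) (auto split: prod.split simp: TC_Atom intro: order_trans[OF card_TC_kp])

lemma card_TC_list_obj: "card (TC (list_obj xs)) \<le> 1 + (\<Sum>x \<leftarrow> xs. 3 + card (TC x))"
proof (induction xs)
  case Nil
  then show ?case using card_TC_num[of 0] by (simp add: num.simps)
next
  case (Cons x xs)
  then show ?case using card_TC_kp[of x "list_obj xs"] by simp
qed

lemma card_TC_list_obj_map:
  assumes "\<And>x. card (TC (f x)) \<le> w x"
  shows "card (TC (list_obj (map f xs))) \<le> 1 + (\<Sum>x \<leftarrow> xs. 3 + w x)"
  by (rule order_trans[OF card_TC_list_obj])
    (auto simp: o_def assms intro!: sum_list_mono)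

fun frame_weight :: "frame \<Rightarrow> nat" where
  "frame_weight (i, d, args, s) = 14 + i + d + 4 * length args + fcard s"

text \<open>Bounds the size of the transitive closure as if no part were shared. It is additive over
  the stacks, so the effect of a step can be read off from what it pushes and pops. The 17 is four
  pairs at 3 each and 1 for each of the five components.\<close>

fun weight :: "conf \<Rightarrow> nat" where
  "weight (q, r, ag, ls, rs) = 17 + q + 5 * fcard r + (\<Sum>f \<leftarrow> ag. 3 + frame_weight f) +
     (\<Sum>a \<leftarrow> ls. 3 + (a + 1)) + (\<Sum>a \<leftarrow> rs. 3 + (a + 1))"

lemma card_TC_frame_obj: "card (TC (frame_obj f)) \<le> frame_weight f"
proof (cases f)
  case (fields i d args s)
  have "card (TC (list_obj (map Atom args))) \<le> 1 + (\<Sum>x \<leftarrow> args. 3 + 1)"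
    by (rule card_TC_list_obj_map) (simp add: TC_Atom)
  then show ?thesis
    using card_TC_kp[of "num i" "kp (num d) (kp (list_obj (map Atom args)) (atoms s))"]
      card_TC_kp[of "num d" "kp (list_obj (map Atom args)) (atoms s)"]
      card_TC_kp[of "list_obj (map Atom args)" "atoms s"]
      card_TC_num[of i] card_TC_num[of d] card_TC_atoms[of s]
    unfolding fields frame_obj.simps frame_weight.simps by (simp add: sum_list_triv)
qed

lemma card_TC_conf_obj: "card (TC (conf_obj c)) \<le> weight c"
proof (cases c)
  case (fields q r ag ls rs)
  let ?q = "num q" and ?r = "order_obj r" and ?ag = "list_obj (map frame_obj ag)"
    and ?ls = "list_obj (map num ls)" and ?rs = "list_obj (map num rs)"
  show ?thesis
    using card_TC_kp[of ?q "kp ?r (kp ?ag (kp ?ls ?rs))"] card_TC_kp[of ?r "kp ?ag (kp ?ls ?rs)"]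
      card_TC_kp[of ?ag "kp ?ls ?rs"] card_TC_kp[of ?ls ?rs] card_TC_num[of q]
      card_TC_order_obj[of r] card_TC_list_obj_map[of frame_obj frame_weight ag, OF card_TC_frame_obj]
      card_TC_list_obj_map[of num "\<lambda>a. a + 1" ls, OF card_TC_num]
      card_TC_list_obj_map[of num "\<lambda>a. a + 1" rs, OF card_TC_num]
    unfolding fields conf_obj.simps weight.simps by linarith
qed


section \<open>Deterministic steps\<close>

context order_simulation_on
begin

lemmas in_next_objs = next_objs_def[THEN eqset_imp_iff, unfolded mem_Collect_eq Bex_rules]

text \<open>The most costly push is a frame: its index is below the number of relations, its depth
  and its arguments (4 each) are covered by \<open>5 * sum_list arity_list\<close>, and its loop set
  by \<open>fcard U\<close>. The new tag and symbol of a machine step are bounded by the numbers of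
  states and symbols, and 40 absorbs the constants.\<close>

definition growth :: nat where
  "growth = 40 + length arity_list + 5 * sum_list arity_list + tm_states M + tm_symbols M + fcard U"

definition halting :: "conf \<Rightarrow> bool" where
  "halting c \<longleftrightarrow> fst c = tm_accept M + 2 \<or> fst c = tm_reject M + 2"

text \<open>The successor must be the same in all states over \<open>S\<close>, so that a trace of
  one configuration can be followed inside the family, whatever the other members are.\<close>

definition det :: "(conf \<times> conf) set" where
  "det = {(c, c'). (\<forall>A. input A = S \<longrightarrow> next_objs A (conf_obj c) = {conf_obj c'}) \<and>
     weight c' \<le> weight c + growth \<and> (halting c \<longrightarrow> fst c' = fst c)}"

lemma detI:
  assumes "\<And>A x. input A = S \<Longrightarrow> x \<in> next_objs A (conf_obj c) \<longleftrightarrow> x = conf_obj c'"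
    and "weight c' \<le> weight c + growth" and "halting c \<Longrightarrow> fst c' = fst c"
  shows "(c, c') \<in> det"
  using assms by (auto simp: det_def)

lemma fires_any_bit:
  "(\<exists>i < length arity_list. \<exists>b. fires A (bit_rule i b) (conf_obj (q, r, ag, ls, rs)) c') \<longleftrightarrow>
    q = 1 \<and> (\<exists>i args s ag'. i < length arity_list \<and> ag = (i, 0, args, s) # ag' \<and>
      c' = conf_obj (1, r, ag', ls,
        (if tru A (env (conf_obj (q, r, ag, ls, rs)) ff) (bitTs ! i) then 2 else 1) # rs))"
  by (auto simp: fires_bit simp del: conf_obj.simps cong: conj_cong)

lemmas fires_simps = in_next_objs fires_extend fires_ordered fires_pop fires_loop fires_start
  fires_any_bit fires_idle

lemma fires_tm_tag:
  assumes "fires A (tm_rule p a) (conf_obj (q, r, ag, ls, rs)) c'"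
  shows "q = p + 2 \<and> head_symbol rs = a"
proof -
  obtain q' a' d where "tm_delta M p a = (q', a', d)" by (cases "tm_delta M p a") auto
  then show ?thesis using assms fires_tm by blast
qed

lemma not_fires_tm [simp]:
  "\<not> fires A (tm_rule p a) (conf_obj (Suc 0, r, ag, ls, rs)) c'"
  using fires_tm_tag by fastforce

lemma det_pop: "((1, r, (i, Suc d, args, {||}) # ag, ls, rs), (1, r, ag, ls, rs)) \<in> det"
  by (rule detI) (auto simp: fires_simps halting_def simp del: conf_obj.simps)

lemma det_start: "((1, r, [], ls, rs), (2, r, [], ls, rs)) \<in> det"
  by (rule detI) (auto simp: fires_simps halting_def growth_def simp del: conf_obj.simps)

text \<open>The loop set is always a prefix of the ascending enumeration, with its greatest element
  last. That element is the only one passing the guard, so a rule that ranges over a set is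
  deterministic here.\<close>

lemma det_loop:
  assumes "sorted_wrt (\<lambda>x y. (x, y) |\<in>| r \<and> (y, x) |\<notin>| r) (ys @ [x])"
    and "i < length arity_list" "Suc d + length args = arity_list ! i"
  shows "((1, r, (i, Suc d, args, fset_of_list (ys @ [x])) # ag, ls, rs),
     (1, r, (i, d, x # args, U) # (i, Suc d, args, fset_of_list ys) # ag, ls, rs)) \<in> det"
proof (rule detI)
  have x: "x \<notin> set ys" using assms(1) by (auto simp: sorted_wrt_append)
  have ne: "fset_of_list (ys @ [x]) \<noteq> {||}" by auto
  have m: "fset_of_list (ys @ [x]) |-| {|x|} = fset_of_list ys"
    using x by (auto simp: fset_of_list_elem)
  have max: "y |\<in>| fset_of_list (ys @ [x]) \<and>
      (\<forall>z. z |\<in>| fset_of_list (ys @ [x]) \<and> (y, z) |\<in>| r \<longrightarrow> y = z) \<longleftrightarrow> y = x" for y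
    using assms(1) x by (auto simp: sorted_wrt_append fset_of_list_elem)
  show "z \<in> next_objs A (conf_obj (1, r, (i, Suc d, args, fset_of_list (ys @ [x])) # ag, ls, rs)) \<longleftrightarrow>
      z = conf_obj (1, r, (i, d, x # args, U) # (i, Suc d, args, fset_of_list ys) # ag, ls, rs)"
    if A: "input A = S" for A z
  proof -
    have "z \<in> next_objs A (conf_obj (1, r, (i, Suc d, args, fset_of_list (ys @ [x])) # ag, ls, rs)) \<longleftrightarrow>
      (\<exists>y. (y |\<in>| fset_of_list (ys @ [x]) \<and>
      (\<forall>z. z |\<in>| fset_of_list (ys @ [x]) \<and> (y, z) |\<in>| r \<longrightarrow> y = z)) \<and>
      z = conf_obj (1, r, (i, d, y # args, U) # (i, Suc d, args, fset_of_list (ys @ [x]) |-| {|y|}) # ag, ls, rs))"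
      using A ne by (auto simp: fires_simps simp del: conf_obj.simps fset_of_list_append fset_of_list_simps)
    then show ?thesis unfolding max using m by auto
  qed
  have "arity_list ! i \<le> sum_list arity_list" using assms(2) by (simp add: elem_le_sum_list)
  moreover have "fcard (fset_of_list ys) \<le> fcard (fset_of_list (ys @ [x]))"
    by (rule fcard_mono) auto
  ultimately show "weight (1, r, (i, d, x # args, U) # (i, Suc d, args, fset_of_list ys) # ag, ls, rs) \<le>
      weight (1, r, (i, Suc d, args, fset_of_list (ys @ [x])) # ag, ls, rs) + growth"
    using assms(2,3) unfolding growth_def by simp
qed (auto simp: halting_def)

definition sym :: "bool \<Rightarrow> nat" where "sym b = (if b then 2 else 1)"

lemma det_bit:
  assumes "i < length arity_list" "length args = arity_list ! i"
  shows "((1, r, (i, 0, args, s) # ag, ls, rs),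
     (1, r, ag, ls, sym (rev args \<in> relations r ! i) # rs)) \<in> det"
proof (rule detI)
  let ?c = "(1, r, (i, 0, args, s) # ag, ls, rs) :: conf"
  show "z \<in> next_objs A (conf_obj ?c) \<longleftrightarrow>
      z = conf_obj (1, r, ag, ls, sym (rev args \<in> relations r ! i) # rs)"
    if A: "input A = S" for A z
  proof -
    have "tru A (env (conf_obj ?c) ff) (bitTs ! i) \<longleftrightarrow> rev args \<in> relations r ! i"
      by (rule tru_bitTs[OF A, where q = 1 and d = 0 and s = s and ag = ag and ls = ls and rs = rs])
        (use assms in auto)
    then show ?thesis
      using A assms(1) by (auto simp: fires_simps sym_def simp del: conf_obj.simps)
  qed
qed (auto simp: halting_def growth_def sym_def)

lemma det_halting:
  assumes "halting (q, r, ag, ls, rs)"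
  shows "((q, r, ag, ls, rs), (q, r, ag, ls, rs)) \<in> det"
proof (rule detI)
  show "z \<in> next_objs A (conf_obj (q, r, ag, ls, rs)) \<longleftrightarrow> z = conf_obj (q, r, ag, ls, rs)"
    if A: "input A = S" for A z
    using A assms fires_tm_tag[of A _ _ q r ag ls rs z]
    by (auto simp: fires_simps halting_def simp del: conf_obj.simps)
qed auto

lemma det_tm:
  assumes "p < tm_states M" "p \<noteq> tm_accept M" "p \<noteq> tm_reject M" "head_symbol rs < tm_symbols M"
    and delta: "tm_delta M p (head_symbol rs) = (p', a', d)"
  shows "((p + 2, r, ag, ls, rs), (p' + 2, r, ag,
      if d = 1 then a' # ls else if d = 0 then ls else tl ls,
      if d = 1 then tl rs else if d = 0 then a' # tl rs else head_symbol ls # a' # tl rs)) \<in> det"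
    (is "(_, ?c') \<in> det")
proof (rule detI)
  show "z \<in> next_objs A (conf_obj (p + 2, r, ag, ls, rs)) \<longleftrightarrow> z = conf_obj ?c'"
    if A: "input A = S" for A z
  proof -
    have "z \<in> next_objs A (conf_obj (p + 2, r, ag, ls, rs)) \<longleftrightarrow>
        (\<exists>p' < tm_states M. p' \<noteq> tm_accept M \<and> p' \<noteq> tm_reject M \<and>
          (\<exists>a < tm_symbols M. fires A (tm_rule p' a) (conf_obj (p + 2, r, ag, ls, rs)) z))"
      using A assms(2,3) by (simp add: fires_simps del: conf_obj.simps)
    also have "\<dots> \<longleftrightarrow> fires A (tm_rule p (head_symbol rs)) (conf_obj (p + 2, r, ag, ls, rs)) z"
      using fires_tm_tag assms(1-4) by (metis add_right_cancel)
    finally show ?thesis using fires_tm[OF delta] by simp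
  qed
  have "p' < tm_states M" "a' < tm_symbols M"
    using tm assms(1,4) delta by (fastforce simp: is_tm_def)+
  then show "weight ?c' \<le> weight (p + 2, r, ag, ls, rs) + growth"
    by (cases ls; cases rs) (simp_all add: growth_def)
qed (use assms in \<open>auto simp: halting_def\<close>)

end

section \<open>Writing the encoding\<close>

text \<open>Depth 0 takes one step to write a bit. A loop takes one step to pop the exhausted frame,
  and each of its \<open>m\<close> rounds takes one step to open the inner frame plus the cost of
  that frame.\<close>

fun cost :: "nat \<Rightarrow> nat \<Rightarrow> nat" where
  "cost 0 m = 1"
| "cost (Suc d) m = 1 + m * (1 + cost d m)"

context order_simulation_on
begin

definition block ::
  "(nat \<times> nat) fset \<Rightarrow> nat list \<Rightarrow> nat \<Rightarrow> nat \<Rightarrow> nat list \<Rightarrow> bool list" where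
  "block r xs i d args =
     map (\<lambda>t. rev args @ t \<in> relations r ! i) (product_lists (replicate d xs))"

lemma block_Suc: "block r xs i (Suc d) args = concat (map (\<lambda>x. block r xs i d (x # args)) xs)"
  by (simp add: block_def map_concat o_def)

text \<open>The last relation is on top, as the string is written from its end.\<close>

definition agenda :: "nat \<Rightarrow> frame list" where
  "agenda k = rev (map (\<lambda>i. (i, arity_list ! i, [], U)) [0..<k])"

context
  fixes r :: "(nat \<times> nat) fset" and xs :: "nat list"
  assumes sorted: "sorted_wrt (\<lambda>x y. (x, y) |\<in>| r \<and> (y, x) |\<notin>| r) xs"
    and xs: "fset_of_list xs = U"
begin

text \<open>Induction on the depth. For a loop, the claim is generalized to prefixes
  \<open>ys\<close> of the enumeration and proved by induction from the right end: the last element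
  is handled first, and its bits end up rightmost.\<close>

lemma trace_frame:
  assumes "i < length arity_list" "d + length args = arity_list ! i"
  shows "((1, r, (i, d, args, U) # ag, ls, rs), (1, r, ag, ls, map sym (block r xs i d args) @ rs))
    \<in> det ^^ cost d (length xs)"
  using assms(2)
proof (induction d arbitrary: args ag rs)
  case 0
  then show ?case using det_bit[OF assms(1)] by (simp add: block_def)
next
  case (Suc d)
  have "((1, r, (i, Suc d, args, fset_of_list ys) # ag, ls, rs),
      (1, r, ag, ls, map sym (concat (map (\<lambda>x. block r xs i d (x # args)) ys)) @ rs))
      \<in> det ^^ (1 + length ys * (1 + cost d (length xs)))"
    if "\<exists>zs. xs = ys @ zs" for ys
    using that
  proof (induction ys arbitrary: rs rule: rev_induct)
    case Nil
    then show ?case using det_pop by simp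
  next
    case (snoc x ys)
    have "sorted_wrt (\<lambda>x y. (x, y) |\<in>| r \<and> (y, x) |\<notin>| r) (ys @ [x])"
      using snoc.prems sorted by (auto simp: sorted_wrt_append)
    then have 1: "((1, r, (i, Suc d, args, fset_of_list (ys @ [x])) # ag, ls, rs),
        (1, r, (i, d, x # args, U) # (i, Suc d, args, fset_of_list ys) # ag, ls, rs)) \<in> det ^^ 1"
      using det_loop[OF _ assms(1)] Suc.prems by simp
    let ?rs = "map sym (block r xs i d (x # args)) @ rs"
    have 2: "((1, r, (i, d, x # args, U) # (i, Suc d, args, fset_of_list ys) # ag, ls, rs),
        (1, r, (i, Suc d, args, fset_of_list ys) # ag, ls, ?rs)) \<in> det ^^ cost d (length xs)"
      using Suc.prems by (intro Suc.IH) simp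
    have 3: "((1, r, (i, Suc d, args, fset_of_list ys) # ag, ls, ?rs),
      (1, r, ag, ls, map sym (concat (map (\<lambda>x. block r xs i d (x # args)) ys)) @ ?rs))
      \<in> det ^^ (1 + length ys * (1 + cost d (length xs)))"
      by (rule snoc.IH) (use snoc.prems in auto)
    show ?case
      using relpow_trans[OF relpow_trans[OF 1 2] 3] by (simp add: algebra_simps)
  qed
  from this[of xs] show ?case by (simp add: xs block_Suc)
qed

lemma trace_agenda:
  assumes "k \<le> length arity_list"
  shows "((1, r, agenda k, ls, rs),
      (1, r, [], ls, map sym (concat (map (\<lambda>i. block r xs i (arity_list ! i) []) [0..<k])) @ rs))
    \<in> det ^^ (\<Sum>i<k. cost (arity_list ! i) (length xs))"
  using assms
proof (induction k arbitrary: rs)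
  case 0
  then show ?case by (simp add: agenda_def)
next
  case (Suc k)
  have "((1, r, agenda (Suc k), ls, rs),
      (1, r, agenda k, ls, map sym (block r xs k (arity_list ! k) []) @ rs))
    \<in> det ^^ cost (arity_list ! k) (length xs)"
    using trace_frame[of k "arity_list ! k" "[]"] Suc.prems by (simp add: agenda_def)
  from relpow_trans[OF this Suc.IH] Suc.prems show ?case by (simp add: add.commute)
qed

end


section \<open>Simulating the machine\<close>

text \<open>The scanned cell is the top of the right stack; the left stack holds the cells to the
  left of the head, nearest first. Through \<open>nth_default\<close>, a list stands for itself
  followed by blanks, so trailing blanks are immaterial.\<close>

fun represents :: "tm_config \<Rightarrow> conf \<Rightarrow> bool" where
  "represents (p, h, tape) (q, r, ag, ls, rs) \<longleftrightarrow> q = p + 2 \<and> p < tm_states M \<and>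
     (\<forall>i. tape i < tm_symbols M) \<and> (\<forall>n. tape (h + int n) = nth_default 0 rs n) \<and>
     (\<forall>n. tape (h - 1 - int n) = nth_default 0 ls n)"

lemma head_symbol_nth_default: "head_symbol xs = nth_default 0 xs 0"
  by (cases xs) auto

lemma nth_default_tl: "nth_default 0 (tl xs) n = nth_default 0 xs (Suc n)"
  by (cases xs) auto

text \<open>Idling mirrors the convention that \<open>tm_step\<close> leaves halted configurations
  unchanged, so the simulation stays step for step even after halting.\<close>

lemma represents_step:
  assumes "represents cfg c"
  shows "\<exists>c'. (c, c') \<in> det \<and> represents (tm_step M cfg) c'"
proof -
  obtain p h tape where cfg: "cfg = (p, h, tape)" by (cases cfg) auto
  obtain q r ag ls rs where c: "c = (q, r, ag, ls, rs)" by (cases c) auto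
  have q: "q = p + 2" and p: "p < tm_states M" and sy: "\<And>i. tape i < tm_symbols M"
    and rs: "\<And>n. tape (h + int n) = nth_default 0 rs n"
    and ls: "\<And>n. tape (h - 1 - int n) = nth_default 0 ls n"
    using assms by (auto simp: cfg c)
  show ?thesis
  proof (cases "p = tm_accept M \<or> p = tm_reject M")
    case True
    then have "(c, c) \<in> det" unfolding c by (intro det_halting) (auto simp: halting_def q)
    moreover have "tm_step M cfg = cfg" using True by (auto simp: cfg tm_step_def)
    ultimately show ?thesis using assms by metis
  next
    case False
    obtain p' a' d where delta: "tm_delta M p (tape h) = (p', a', d)"
      by (cases "tm_delta M p (tape h)") auto
    have d: "d = 1 \<or> d = 0 \<or> d = -1" and p': "p' < tm_states M" and a': "a' < tm_symbols M"
      using tm p sy[of h] delta by (fastforce simp: is_tm_def)+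
    have head_symbol: "head_symbol rs = tape h" using rs[of 0] by (simp add: head_symbol_nth_default)
    define ls' where "ls' = (if d = 1 then a' # ls else if d = 0 then ls else tl ls)"
    define rs' where "rs' = (if d = 1 then tl rs else if d = 0 then a' # tl rs else head_symbol ls # a' # tl rs)"
    have det: "(c, (p' + 2, r, ag, ls', rs')) \<in> det"
      unfolding c q ls'_def rs'_def using False p sy[of h] delta by (intro det_tm) (auto simp: head_symbol)
    have right: "tape (h + 1 + int n) = nth_default 0 (tl rs) n" for n
      using rs[of "Suc n"] by (simp add: nth_default_tl algebra_simps)
    have left: "tape (h - 2 - int n) = nth_default 0 (tl ls) n" for n
      using ls[of "Suc n"] by (simp add: nth_default_tl algebra_simps)
    have "(tape(h := a')) (h + d + int n) = nth_default 0 rs' n" for n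
    proof -
      consider "d = 1" | "d = 0" | "d = -1" using d by blast
      then show ?thesis
      proof cases
        case 1 then show ?thesis using right[of n] by (simp add: rs'_def)
      next
        case 2 then show ?thesis using right[of "n - 1"] by (cases n) (auto simp: rs'_def add.assoc)
      next
        case 3
        then have rs': "rs' = head_symbol ls # a' # tl rs" by (simp add: rs'_def)
        show ?thesis
        proof (cases n)
          case 0 then show ?thesis using 3 ls[of 0] by (simp add: rs' head_symbol_nth_default)
        next
          case (Suc k) then show ?thesis using 3 right[of "k - 1"] by (cases k) (auto simp: rs' algebra_simps)
        qed
      qed
    qed
    moreover have "(tape(h := a')) (h + d - 1 - int n) = nth_default 0 ls' n" for n
    proof -
      consider "d = 1" | "d = 0" | "d = -1" using d by blast
      then show ?thesis
      proof cases
        case 1 then show ?thesis using ls[of "n - 1"] by (cases n) (auto simp: ls'_def algebra_simps)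
      next
        case 2 then show ?thesis using ls[of n] by (simp add: ls'_def)
      next
        case 3 then show ?thesis using left[of n] by (simp add: ls'_def)
      qed
    qed
    ultimately have "represents (tm_step M cfg) (p' + 2, r, ag, ls', rs')"
      using False delta p' a' sy by (simp add: cfg tm_step_def)
    with det show ?thesis by blast
  qed
qed

lemma represents_steps:
  "represents cfg c \<Longrightarrow> \<exists>c'. (c, c') \<in> det ^^ n \<and> represents ((tm_step M ^^ n) cfg) c'"
proof (induction n)
  case 0
  then show ?case by auto
next
  case (Suc n)
  then obtain c' where c': "(c, c') \<in> det ^^ n" "represents ((tm_step M ^^ n) cfg) c'" by blast
  obtain c'' where c'': "(c', c'') \<in> det" "represents (tm_step M ((tm_step M ^^ n) cfg)) c''"
    using represents_step[OF c'(2)] by blast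
  show ?case by (rule exI[of _ c'']) (use relpow_Suc_I[OF c'(1) c''(1)] c''(2) in simp)
qed

lemma represents_init: "represents (tm_init s) (2, r, ag, [], map sym s)"
proof -
  have "3 \<le> tm_symbols M" "0 < tm_states M" using tm by (auto simp: is_tm_def)
  then show ?thesis by (auto simp: tm_init_def nth_default_def sym_def)
qed

lemma trace_tm:
  "\<exists>c'. ((2, r, ag, [], map sym s), c') \<in> det ^^ n \<and> fst c' = tm_state_at M s n + 2"
proof -
  obtain c' where c': "((2, r, ag, [], map sym s), c') \<in> det ^^ n"
    "represents ((tm_step M ^^ n) (tm_init s)) c'"
    using represents_steps[OF represents_init] by blast
  then have "fst c' = fst ((tm_step M ^^ n) (tm_init s)) + 2"
    by (cases "((tm_step M ^^ n) (tm_init s), c')" rule: represents.cases) simp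
  with c'(1) show ?thesis unfolding tm_state_at_def by blast
qed

end

section \<open>Encodings of ordered structures\<close>

text \<open>If the two heads differed, each would occur in the tail of the other list, hence each
  would be below the other, against irreflexivity.\<close>

lemma sorted_wrt_distinct_unique:
  assumes "trans r" "irrefl r" "sorted_wrt (\<lambda>x y. (x, y) \<in> r) xs"
    "sorted_wrt (\<lambda>x y. (x, y) \<in> r) ys" "set xs = set ys"
  shows "xs = ys"
  using assms(3-5)
proof (induction xs arbitrary: ys)
  case Nil
  then show ?case by simp
next
  case (Cons x xs)
  then obtain y ys' where ys: "ys = y # ys'" by (cases ys) auto
  have irr: "(a, a) \<notin> r" for a using assms(2) by (auto simp: irrefl_def)
  have "x = y"
  proof (rule ccontr)
    assume "x \<noteq> y"
    then have "x \<in> set ys'" "y \<in> set xs" using Cons.prems(3) ys by auto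
    then have "(x, y) \<in> r" "(y, x) \<in> r" using Cons.prems(1,2) ys by auto
    then show False using assms(1) irr by (meson transD)
  qed
  moreover have "x \<notin> set xs" "y \<notin> set ys'" using Cons.prems(1,2) ys irr by auto
  then have "set xs = set ys'" using Cons.prems(3) ys \<open>x = y\<close> by auto
  ultimately show ?case using Cons ys by simp
qed

lemma sorted_list_exists:
  assumes "trans r" "total_on A r" "finite A"
  shows "\<exists>xs. distinct xs \<and> set xs = A \<and> sorted_wrt (\<lambda>x y. (x, y) \<in> r) xs"
  using assms(3,2)
proof (induction A)
  case empty
  then show ?case by simp
next
  case (insert a A)
  then obtain xs where xs: "distinct xs" "set xs = A" "sorted_wrt (\<lambda>x y. (x, y) \<in> r) xs"
    by (auto simp: total_on_def)
  have tot: "(x, a) \<in> r \<or> (a, x) \<in> r" if "x \<in> A" for x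
    using that insert by (auto simp: total_on_def)
  let ?ys = "filter (\<lambda>x. (x, a) \<in> r) xs @ a # filter (\<lambda>x. (x, a) \<notin> r) xs"
  have "(x, y) \<in> r" if "x \<in> A" "y \<in> A" "(x, a) \<in> r" "(y, a) \<notin> r" for x y
    using that tot[of y] assms(1) by (meson transD)
  then have "sorted_wrt (\<lambda>x y. (x, y) \<in> r) ?ys"
    using xs tot by (auto simp: sorted_wrt_append sorted_wrt_filter)
  moreover have "distinct ?ys" "set ?ys = insert a A" using xs insert.hyps by auto
  ultimately show ?case by blast
qed

lemma enumeration_eqI:
  assumes "strict_linear_order_on (universe C) (less_of C)" "distinct xs" "set xs = universe C"
    "sorted_wrt (\<lambda>x y. (x, y) \<in> less_of C) xs"
  shows "enumeration C = xs"
  unfolding enumeration_def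
proof (rule the_equality)
  fix ys assume "distinct ys \<and> set ys = universe C \<and> sorted_wrt (\<lambda>x y. (x, y) \<in> less_of C) ys"
  then show "ys = xs"
    using assms sorted_wrt_distinct_unique[of "less_of C" ys xs]
    by (simp add: strict_linear_order_on_def)
qed (use assms in auto)

lemma enumeration:
  assumes "strict_linear_order_on (universe C) (less_of C)" "finite (universe C)"
  shows "distinct (enumeration C)" "set (enumeration C) = universe C"
    "sorted_wrt (\<lambda>x y. (x, y) \<in> less_of C) (enumeration C)"
proof -
  obtain xs where "distinct xs" "set xs = universe C" "sorted_wrt (\<lambda>x y. (x, y) \<in> less_of C) xs"
    using sorted_list_exists assms unfolding strict_linear_order_on_def by blast
  with enumeration_eqI[OF assms(1) this]
  show "distinct (enumeration C)" "set (enumeration C) = universe C"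
    "sorted_wrt (\<lambda>x y. (x, y) \<in> less_of C) (enumeration C)" by simp_all
qed

lemma product_lists_map: "product_lists (map (map f) xss) = map (map f) (product_lists xss)"
  by (induction xss) (simp_all add: map_concat o_def)

lemma in_set_product_lists_replicate:
  "t \<in> set (product_lists (replicate n xs)) \<longleftrightarrow> length t = n \<and> set t \<subseteq> set xs"
proof (induction n arbitrary: t)
  case 0
  then show ?case by auto
next
  case (Suc n)
  then show ?case by (cases t) auto
qed

definition bits :: "nat list \<Rightarrow> nat \<Rightarrow> nat list set \<Rightarrow> bool list" where
  "bits xs r R = map (\<lambda>t. t \<in> R) (product_lists (replicate r xs))"

lemma length_bits: "length (bits xs r R) = length xs ^ r"
  unfolding bits_def
  by (induction r) (simp_all add: length_concat o_def sum_list_triv)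

lemma encoding_eq:
  "encoding \<Upsilon> C = replicate (length (enumeration C)) True @ [False] @
     concat (map2 (bits (enumeration C)) \<Upsilon> (rels C))"
  by (simp add: encoding_def bits_def Let_def cong: map_cong)

text \<open>The block of an \<open>r\<close>-ary relation has length \<open>n ^ r\<close>, which
  depends only on \<open>r\<close> and the length \<open>n\<close> of the enumeration; so equal
  concatenations are cut at the same places.\<close>

lemma concat_map2_inject:
  assumes "length Rs = length \<Upsilon>" "length Ss = length \<Upsilon>" "length xs = length ys"
    and "concat (map2 (bits xs) \<Upsilon> Rs) = concat (map2 (bits ys) \<Upsilon> Ss)" and "i < length \<Upsilon>"
  shows "bits xs (\<Upsilon> ! i) (Rs ! i) = bits ys (\<Upsilon> ! i) (Ss ! i)"
  using assms
proof (induction \<Upsilon> arbitrary: Rs Ss i)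
  case Nil
  then show ?case by simp
next
  case (Cons r \<Upsilon>)
  then obtain R Rs' S Ss' where "Rs = R # Rs'" "Ss = S # Ss'" by (auto simp: length_Suc_conv)
  with Cons show ?case
    by (cases i) (auto simp: length_bits append_eq_append_conv)
qed

text \<open>The map \<open>h\<close> matches the enumerations position by position, hence also the
  lexicographic lists of tuples over them; equal bits at equal positions then say that
  \<open>h\<close> preserves and reflects the relation.\<close>

lemma bits_eq_imp_image:
  assumes "distinct xs" "distinct ys" "length xs = length ys"
    and "R \<subseteq> {t. length t = r \<and> set t \<subseteq> set xs}" "S \<subseteq> {t. length t = r \<and> set t \<subseteq> set ys}"
    and "bits xs r R = bits ys r S" and h: "\<And>i. i < length xs \<Longrightarrow> h (xs ! i) = ys ! i"
  shows "S = map h ` R"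
proof -
  have ys: "ys = map h xs" using assms(3) h by (intro nth_equalityI) auto
  have inj: "inj_on h (set xs)" using assms(2) by (simp add: ys distinct_map)
  have "product_lists (replicate r ys) = map (map h) (product_lists (replicate r xs))"
    by (simp add: ys flip: product_lists_map)
  then have "\<forall>t \<in> set (product_lists (replicate r xs)). t \<in> R \<longleftrightarrow> map h t \<in> S"
    using assms(6) by (simp add: bits_def)
  then have eq: "t \<in> R \<longleftrightarrow> map h t \<in> S" if "length t = r" "set t \<subseteq> set xs" for t
    using that by (simp add: in_set_product_lists_replicate)
  show ?thesis
  proof (intro equalityI subsetI)
    fix u assume "u \<in> S"
    then have u: "length u = r" "set u \<subseteq> h ` set xs" using assms(5) by (auto simp: ys)
    then have "u \<in> lists (h ` set xs)" by auto
    then obtain t where "u = map h t" "set t \<subseteq> set xs" by (auto simp: lists_image)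
    then show "u \<in> map h ` R" using u eq \<open>u \<in> S\<close> by auto
  next
    fix u assume "u \<in> map h ` R"
    then show "u \<in> S" using eq assms(4) by auto
  qed
qed

lemma encoding_eq_imp_iso:
  assumes C: "is_struct (\<Upsilon> @ [2]) C" "strict_linear_order_on (universe C) (less_of C)"
    and D: "is_struct (\<Upsilon> @ [2]) D" "strict_linear_order_on (universe D) (less_of D)"
    and eq: "encoding (\<Upsilon> @ [2]) C = encoding (\<Upsilon> @ [2]) D"
  shows "iso (reduct \<Upsilon> C) (reduct \<Upsilon> D)"
proof -
  let ?xs = "enumeration C" and ?ys = "enumeration D"
  have fin: "finite (universe C)" "finite (universe D)" using C D by (auto simp: is_struct_def)
  note xs = enumeration[OF C(2) fin(1)] and ys = enumeration[OF D(2) fin(2)]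
  \<comment> \<open>The zero that ends the leading block of ones makes the size of the universe
    recoverable from the string.\<close>
  have pre: "takeWhile id (replicate n True @ [False] @ bs) = replicate n True" for n bs
    by (induction n) auto
  from arg_cong[OF eq, of "takeWhile id"] have len: "length ?xs = length ?ys"
    unfolding encoding_eq pre by (metis length_replicate)
  have lC: "length (rels C) = Suc (length \<Upsilon>)" and lD: "length (rels D) = Suc (length \<Upsilon>)"
    using C(1) D(1) by (auto simp: is_struct_def dest: list_all2_lengthD)
  have con: "concat (map2 (bits ?xs) (\<Upsilon> @ [2]) (rels C)) = concat (map2 (bits ?ys) (\<Upsilon> @ [2]) (rels D))"
    using eq len by (simp add: encoding_eq)
  define h where "h x = ?ys ! (THE i. i < length ?xs \<and> ?xs ! i = x)" for x
  have h: "h (?xs ! i) = ?ys ! i" if "i < length ?xs" for i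
  proof -
    have "(THE k. k < length ?xs \<and> ?xs ! k = ?xs ! i) = i"
      using that xs(1) by (intro the_equality) (auto simp: nth_eq_iff_index_eq)
    then show ?thesis by (simp add: h_def)
  qed
  have ys_map: "?ys = map h ?xs" using len h by (intro nth_equalityI) auto
  have "bij_betw h (universe C) (universe D)"
    using xs ys ys_map by (auto simp: bij_betw_def distinct_map)
  moreover have "rels D ! i = map h ` (rels C ! i)" if i: "i < length \<Upsilon>" for i
  proof (rule bits_eq_imp_image)
    show "bits ?xs ((\<Upsilon> @ [2]) ! i) (rels C ! i) = bits ?ys ((\<Upsilon> @ [2]) ! i) (rels D ! i)"
      by (rule concat_map2_inject[OF _ _ len con]) (use lC lD i in auto)
    show "rels C ! i \<subseteq> {t. length t = (\<Upsilon> @ [2]) ! i \<and> set t \<subseteq> set ?xs}"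
      "rels D ! i \<subseteq> {t. length t = (\<Upsilon> @ [2]) ! i \<and> set t \<subseteq> set ?ys}"
      using C(1) D(1) i unfolding xs(2) ys(2)
      by (auto simp: is_struct_def list_all2_conv_all_nth dest!: spec[of _ i])
  qed (use xs ys len h in auto)
  then have "take (length \<Upsilon>) (rels D) = map (\<lambda>R. map h ` R) (take (length \<Upsilon>) (rels C))"
    using lC lD by (intro nth_equalityI) auto
  ultimately show ?thesis by (auto simp: iso_def reduct_def)
qed

section \<open>Isomorphism and the closure of the class\<close>

lemma iso_refl: "iso S S"
  by (auto simp: iso_def intro!: exI[of _ id])

text \<open>Well-formedness keeps all tuples inside the universe, where \<open>inv_into\<close>
  really inverts the bijection.\<close>

lemma iso_sym:
  assumes "is_struct \<Upsilon> S" "iso S T"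
  shows "iso T S"
proof -
  obtain h where h: "bij_betw h (universe S) (universe T)" "rels T = map (\<lambda>R. map h ` R) (rels S)"
    using assms(2) by (auto simp: iso_def)
  let ?g = "inv_into (universe S) h"
  have "map ?g ` map h ` R = R" if R: "R \<in> set (rels S)" for R
  proof -
    obtain i where i: "i < length (rels S)" "R = rels S ! i"
      using R by (auto simp: in_set_conv_nth)
    have "R \<subseteq> {t. length t = \<Upsilon> ! i \<and> set t \<subseteq> universe S}"
      using assms(1) i by (simp add: is_struct_def list_all2_conv_all_nth)
    then have sub: "set t \<subseteq> universe S" if "t \<in> R" for t using that by blast
    have "map ?g (map h t) = t" if "t \<in> R" for t
      unfolding map_map
    proof (rule map_idI)
      fix x assume "x \<in> set t"
      then have "x \<in> universe S" using sub[OF that] by blast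
      then show "(?g \<circ> h) x = x" using h(1) by (simp add: bij_betw_def)
    qed
    then show ?thesis by (simp add: image_image del: map_map)
  qed
  then have "rels S = map (\<lambda>R. map ?g ` R) (rels T)"
    unfolding h(2) map_map by (intro map_idI[symmetric]) simp
  then show ?thesis using bij_betw_inv_into[OF h(1)] by (auto simp: iso_def)
qed

lemma iso_trans:
  assumes "iso S T" "iso T V"
  shows "iso S V"
proof -
  obtain h g where "bij_betw h (universe S) (universe T)" "rels T = map (\<lambda>R. map h ` R) (rels S)"
    "bij_betw g (universe T) (universe V)" "rels V = map (\<lambda>R. map g ` R) (rels T)"
    using assms by (auto simp: iso_def)
  then show ?thesis
    by (auto simp: iso_def image_image o_def intro!: exI[of _ "g \<circ> h"] bij_betw_trans)
qed

text \<open>An accepted string may come from an ordered version of some other \<open>B'\<close> in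
  the class. Equal encodings make the reducts isomorphic, and closure under isomorphism brings
  membership back to \<open>B\<close>. So the verdict does not depend on the chosen order.\<close>

lemma ptime_class_encoding:
  assumes K: "\<And>B. B \<in> K \<Longrightarrow> is_struct \<Upsilon> B" "\<And>B C. B \<in> K \<Longrightarrow> is_struct \<Upsilon> C \<Longrightarrow> iso B C \<Longrightarrow> C \<in> K"
    and M: "\<And>s. tm_accepts M s \<longleftrightarrow>
      (\<exists>B \<in> K. \<exists>C. ordered_version \<Upsilon> B C \<and> s = encoding (\<Upsilon> @ [2]) C)"
    and C: "ordered_version \<Upsilon> B C" and B: "is_struct \<Upsilon> B"
  shows "tm_accepts M (encoding (\<Upsilon> @ [2]) C) \<longleftrightarrow> B \<in> K"
proof
  assume "tm_accepts M (encoding (\<Upsilon> @ [2]) C)"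
  then obtain B' C' where B': "B' \<in> K" "ordered_version \<Upsilon> B' C'"
    "encoding (\<Upsilon> @ [2]) C = encoding (\<Upsilon> @ [2]) C'" using M by blast
  then have iso: "iso (reduct \<Upsilon> C') (reduct \<Upsilon> C)"
    using C by (intro encoding_eq_imp_iso) (auto simp: ordered_version_def)
  have "is_struct \<Upsilon> (reduct \<Upsilon> C')"
    using B'(2) by (auto simp: ordered_version_def is_struct_def reduct_def list_all2_append1)
  then have "iso B' (reduct \<Upsilon> C')" using B'(2) iso_sym by (auto simp: ordered_version_def)
  then have "iso B' B" using iso C by (meson iso_trans ordered_version_def)
  then show "B \<in> K" using K(2) B'(1) B by blast
next
  assume "B \<in> K"
  then show "tm_accepts M (encoding (\<Upsilon> @ [2]) C)" using M C by blast
qed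

section \<open>Linear orders\<close>

text \<open>The head of the list is the element placed last, so consing is exactly one use of
  \<open>extend_rule\<close>, and \<open>rev zs\<close> is the ascending enumeration.\<close>

fun chain_order :: "nat list \<Rightarrow> (nat \<times> nat) fset" where
  "chain_order [] = {||}"
| "chain_order (x # zs) = chain_order zs |\<union>| (\<lambda>y. (y, x)) |`| fset_of_list (x # zs)"

lemma chain_order_set: "(x, y) |\<in>| chain_order zs \<Longrightarrow> x \<in> set zs \<and> y \<in> set zs"
  by (induction zs) (auto simp: fset_of_list_elem)

lemma chain_order_refl [simp]: "(x, x) |\<in>| chain_order zs \<longleftrightarrow> x \<in> set zs"
  using chain_order_set by (induction zs) (auto simp: fset_of_list_elem)

lemma chain_order_Cons [simp]:
  "(a, b) |\<in>| chain_order (x # zs) \<longleftrightarrow>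
    (a, b) |\<in>| chain_order zs \<or> b = x \<and> (a = x \<or> a \<in> set zs)"
  by (auto simp: fset_of_list_elem)

declare chain_order.simps(2) [simp del]

lemma sorted_chain_order:
  "distinct zs \<Longrightarrow>
    sorted_wrt (\<lambda>x y. (x, y) |\<in>| chain_order zs \<and> (y, x) |\<notin>| chain_order zs) (rev zs)"
proof (induction zs)
  case (Cons z zs)
  have "sorted_wrt (\<lambda>x y. (x, y) |\<in>| chain_order (z # zs) \<and> (y, x) |\<notin>| chain_order (z # zs)) (rev zs)"
    by (rule sorted_wrt_mono_rel[OF _ Cons.IH]) (use Cons.prems in auto)
  then show ?case using Cons.prems by (auto simp: sorted_wrt_append dest: chain_order_set)
qed simp

lemma chain_order_trans:
  "distinct zs \<Longrightarrow> (a, b) |\<in>| chain_order zs \<Longrightarrow> (b, c) |\<in>| chain_order zs \<Longrightarrow>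
    (a, c) |\<in>| chain_order zs"
  by (induction zs) (auto dest: chain_order_set)

lemma chain_order_antisym:
  "distinct zs \<Longrightarrow> (a, b) |\<in>| chain_order zs \<Longrightarrow> (b, a) |\<in>| chain_order zs \<Longrightarrow> a = b"
  by (induction zs) (auto dest: chain_order_set)

lemma chain_order_total:
  "a \<in> set zs \<Longrightarrow> b \<in> set zs \<Longrightarrow> (a, b) |\<in>| chain_order zs \<or> (b, a) |\<in>| chain_order zs"
  by (induction zs) auto

lemma fcard_chain_order:
  assumes "set zs \<subseteq> V" "finite V"
  shows "fcard (chain_order zs) \<le> card V * card V"
proof -
  have "fset (chain_order zs) \<subseteq> V \<times> V" using assms(1) chain_order_set by force
  then have "card (fset (chain_order zs)) \<le> card (V \<times> V)"
    using assms(2) by (intro card_mono) auto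
  then show ?thesis by (simp add: fcard.rep_eq card_cartesian_product)
qed

section \<open>Chains of elements of \<open>U\<close> and the ordered versions they define\<close>

context order_simulation_on
begin

abbreviation m :: nat where "m \<equiv> card (U_set \<Upsilon> S)"

text \<open>Steps after the order is complete: writing the string, \<open>n\<close> machine steps,
  and 2 for the changes of tag from 0 to 1 and from 1 to 2.\<close>

definition duration :: "nat \<Rightarrow> nat" where
  "duration n = (\<Sum>i<length arity_list. cost (arity_list ! i) m) + n + 2"

definition ordered :: "nat list \<Rightarrow> fin_struct" where
  "ordered zs = \<lparr>universe = U_set \<Upsilon> S,
     rels = rels (U_part \<Upsilon> S) @ [{[x, y] | x y. (x, y) |\<in>| chain_order zs \<and> x \<noteq> y}]\<rparr>"

lemma finite_U_set: "finite (U_set \<Upsilon> S)"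
  using U_set_subset struct by (auto simp: is_struct_def finite_subset)

lemma is_struct_U_part: "is_struct \<Upsilon> (U_part \<Upsilon> S)"
proof -
  have "rels S ! i \<subseteq> {t. length t = \<Upsilon> ! i}" if "i < length \<Upsilon>" for i
    using struct that
    by (auto simp: is_struct_def list_all2_conv_all_nth nth_append dest!: spec[of _ i])
  then show ?thesis
    using finite_U_set length_rels
    by (auto simp: is_struct_def U_part_def reduct_def substructure_def list_all2_conv_all_nth)
qed

context
  fixes zs :: "nat list"
  assumes zs: "distinct zs" "set zs = U_set \<Upsilon> S"
begin

lemma less_of_ordered:
  "less_of (ordered zs) = {(x, y). (x, y) |\<in>| chain_order zs \<and> x \<noteq> y}"
  by (auto simp: less_of_def ordered_def)

lemma strict_linear_order_ordered:
  "strict_linear_order_on (universe (ordered zs)) (less_of (ordered zs))"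
  unfolding strict_linear_order_on_def less_of_ordered
proof (intro conjI)
  show "trans {(x, y). (x, y) |\<in>| chain_order zs \<and> x \<noteq> y}"
    using chain_order_trans[OF zs(1)] chain_order_antisym[OF zs(1)] by (auto intro!: transI)
  show "irrefl {(x, y). (x, y) |\<in>| chain_order zs \<and> x \<noteq> y}" by (auto simp: irrefl_def)
  show "total_on (universe (ordered zs)) {(x, y). (x, y) |\<in>| chain_order zs \<and> x \<noteq> y}"
    using chain_order_total zs(2) by (auto simp: total_on_def ordered_def)
qed

lemma ordered_version_ordered: "ordered_version \<Upsilon> (U_part \<Upsilon> S) (ordered zs)"
proof -
  have "length (rels (U_part \<Upsilon> S)) = length \<Upsilon>"
    using is_struct_U_part by (auto simp: is_struct_def dest: list_all2_lengthD)
  then have "reduct \<Upsilon> (ordered zs) = U_part \<Upsilon> S"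
    by (simp add: reduct_def ordered_def) (simp add: U_part_def reduct_def substructure_def)
  moreover have "is_struct (\<Upsilon> @ [2]) (ordered zs)"
    using is_struct_U_part chain_order_set zs(2)
    by (fastforce simp: is_struct_def ordered_def U_part_def reduct_def substructure_def
        intro!: list_all2_appendI)
  ultimately show ?thesis
    using strict_linear_order_ordered by (simp add: ordered_version_def iso_refl)
qed

lemma enumeration_ordered: "enumeration (ordered zs) = rev zs"
proof (rule enumeration_eqI[OF strict_linear_order_ordered])
  show "sorted_wrt (\<lambda>x y. (x, y) \<in> less_of (ordered zs)) (rev zs)"
    unfolding less_of_ordered
    by (rule sorted_wrt_mono_rel[OF _ sorted_chain_order[OF zs(1)]]) auto
qed (use zs in \<open>auto simp: ordered_def\<close>)

lemma fset_of_list_rev: "fset_of_list (rev zs) = U"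
  using zs(2) by (simp add: fset_inject[symmetric] fset_of_list.rep_eq del: fset_inject)

lemma concat_block:
  "concat (map (\<lambda>i. block (chain_order zs) (rev zs) i (arity_list ! i) []) [0..<length arity_list]) =
    encoding (\<Upsilon> @ [2]) (ordered zs)"
proof -
  let ?r = "chain_order zs" and ?xs = "rev zs"
  let ?L = "{[x, y] | x y. (x, y) |\<in>| ?r \<and> x \<noteq> y}"
  have len: "length (relations ?r) = length arity_list"
    using length_rels by (simp add: relations_def arity_list_def)
  have "map (\<lambda>i. block ?r ?xs i (arity_list ! i) []) [0..<length arity_list] =
      map2 (bits ?xs) arity_list (relations ?r)"
    by (rule nth_equalityI) (use len in \<open>auto simp: block_def bits_def\<close>)
  also have "\<dots> = replicate (length ?xs) True # [False] #
      map2 (bits ?xs) (\<Upsilon> @ [2]) (take (length \<Upsilon>) (rels S) @ [?L])"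
  proof -
    have "bits ?xs 1 UNIV = replicate (length ?xs) True" for xs :: "nat list"
      by (simp add: bits_def o_def map_replicate_const)
    then show ?thesis by (simp add: arity_list_def relations_def bits_def)
  qed
  also have "map2 (bits ?xs) (\<Upsilon> @ [2]) (take (length \<Upsilon>) (rels S) @ [?L]) =
      map2 (bits ?xs) (\<Upsilon> @ [2]) (rels (ordered zs))"
  proof (rule nth_equalityI)
    have l: "length (rels (ordered zs)) = Suc (length \<Upsilon>)"
      using length_rels by (simp add: ordered_def U_part_def reduct_def substructure_def)
    then show "length (map2 (bits ?xs) (\<Upsilon> @ [2]) (take (length \<Upsilon>) (rels S) @ [?L])) =
        length (map2 (bits ?xs) (\<Upsilon> @ [2]) (rels (ordered zs)))"
      using length_rels by simp
    \<comment> \<open>The program queries the relations of the whole structure, but only at tuples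
      over \<open>U\<close>, where they agree with those of the substructure.\<close>
    have "bits ?xs d (R \<inter> lists (U_set \<Upsilon> S)) = bits ?xs d R" for d R
      by (auto simp: bits_def in_set_product_lists_replicate zs(2))
    then show "map2 (bits ?xs) (\<Upsilon> @ [2]) (take (length \<Upsilon>) (rels S) @ [?L]) ! i =
        map2 (bits ?xs) (\<Upsilon> @ [2]) (rels (ordered zs)) ! i"
      if "i < length (map2 (bits ?xs) (\<Upsilon> @ [2]) (take (length \<Upsilon>) (rels S) @ [?L]))" for i
      using that l length_rels
      by (auto simp: nth_append ordered_def U_part_def reduct_def substructure_def)
  qed
  finally show ?thesis by (simp add: encoding_eq enumeration_ordered)
qed

text \<open>The length depends only on \<open>|U|\<close>, so a single time bound serves the
  computations for all orders.\<close>

lemma length_encoding_ordered: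
  "length (encoding (\<Upsilon> @ [2]) (ordered zs)) = (\<Sum>a \<leftarrow> arity_list. m ^ a)"
proof -
  have "length zs = m" using zs distinct_card by metis
  then have "length (block r (rev zs) i d []) = m ^ d" for r i d
    using length_bits[of "rev zs" d "relations r ! i"] by (simp add: block_def bits_def)
  then have "length (encoding (\<Upsilon> @ [2]) (ordered zs)) =
      (\<Sum>a \<leftarrow> map (\<lambda>i. arity_list ! i) [0..<length arity_list]. m ^ a)"
    unfolding concat_block[symmetric]
    by (simp add: length_concat o_def)
  then show ?thesis by (simp only: map_nth)
qed

lemma det_ordered:
  "((0, chain_order zs, ag, ls, rs), (1, chain_order zs, ag, ls, rs)) \<in> det"
  by (rule detI) (use zs(2) in \<open>auto simp: fires_simps halting_def growth_def fmember_U
      simp del: conf_obj.simps fset_U dest!: fires_tm_tag\<close>)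

lemma trace_ordered:
  "\<exists>c'. ((0, chain_order zs, agenda (length arity_list), [], []), c') \<in> det ^^ duration n \<and>
     fst c' = tm_state_at M (encoding (\<Upsilon> @ [2]) (ordered zs)) n + 2"
proof -
  let ?r = "chain_order zs" and ?s = "encoding (\<Upsilon> @ [2]) (ordered zs)"
  have len: "length zs = m" using zs distinct_card by metis
  have 1: "((0, ?r, agenda (length arity_list), [], []), (1, ?r, agenda (length arity_list), [], [])) \<in> det ^^ 1"
    using det_ordered by simp
  have 2: "((1, ?r, agenda (length arity_list), [], []), (1, ?r, [], [], map sym ?s))
      \<in> det ^^ (\<Sum>i<length arity_list. cost (arity_list ! i) m)"
    using trace_agenda[OF sorted_chain_order[OF zs(1)] fset_of_list_rev, of "length arity_list" "[]" "[]"]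
    by (simp add: concat_block flip: len)
  have 3: "((1, ?r, [], [], map sym ?s), (2, ?r, [], [], map sym ?s)) \<in> det ^^ 1"
    using det_start by simp
  obtain c' where c': "((2, ?r, [], [], map sym ?s), c') \<in> det ^^ n" "fst c' = tm_state_at M ?s n + 2"
    using trace_tm by blast
  have "((0, ?r, agenda (length arity_list), [], []), c') \<in> det ^^ duration n"
    using relpow_trans[OF relpow_trans[OF relpow_trans[OF 1 2] 3] c'(1)] by (simp add: duration_def)
  then show ?thesis using c'(2) by blast
qed

end
end

section \<open>The program and its run\<close>

context order_simulation
begin

definition listT :: "trm list \<Rightarrow> trm" where "listT ts = foldr KP ts EmptyT"

definition startT :: trm where
  "startT = confT (NumT 0) EmptyT
     (listT (rev (map (\<lambda>i. frameT (NumT i) (NumT (arity_list ! i)) EmptyT uT) [0..<length arity_list])))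
     EmptyT EmptyT"

definition confsT :: trm where "confsT = App (Dyn (Aux 0)) []"

definition nextT :: trm where
  "nextT = UnionsT (map (\<lambda>(r, g, t). BigUnT (Compr (Compr t 1 r g) 0 confsT TrueT)) rules)"

definition acceptingT :: trm where "acceptingT = EqT tagT (NumT (tm_accept M + 2))"
definition rejectingT :: trm where "rejectingT = EqT tagT (NumT (tm_reject M + 2))"

text \<open>Since there is no parallel composition, the last step sets both \<open>Halt\<close> and \<open>Output\<close> in a loop.\<close>

definition main :: asm_rule where
  "main = Cond (EqT confsT EmptyT) (Update (Aux 0) [] (PairT startT startT))
     (Cond (ExT 0 confsT (NotT (OrT acceptingT rejectingT))) (Update (Aux 0) [] nextT)
       (Forall 0 (PairT EmptyT oneT)
         (Cond (EqT (Var 0) EmptyT) (Update Halt [] TrueT)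
           (Update Output [] (ExT 0 confsT acceptingT)))))"

definition simulation :: program where
  "simulation = \<lparr>dyn_voc = [(0, False)], body = main\<rparr>"

definition rule_ok :: "step_rule \<Rightarrow> bool" where
  "rule_ok \<rho> \<longleftrightarrow> (case \<rho> of (r, g, t) \<Rightarrow>
     wf_trm (\<Upsilon> @ [1]) [(0, False)] r \<and> wf_trm (\<Upsilon> @ [1]) [(0, False)] g \<and>
     wf_trm (\<Upsilon> @ [1]) [(0, False)] t \<and> bool_trm [(0, False)] g \<and>
     fv_trm r \<subseteq> {0} \<and> fv_trm g \<subseteq> {0, 1} \<and> fv_trm t \<subseteq> {0, 1})"

lemma fv_uT [simp]: "fv_trm uT = {}" by (simp add: uT_def)

lemma wf_uT [simp]: "wf_trm (\<Upsilon> @ [Suc 0]) D uT"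
  by (simp add: uT_def valid_def arity_def relational_def)

lemma tupleT_ok: "length (tupleT r) = r" "t \<in> set (tupleT r) \<Longrightarrow> wf_trm V D t \<and> fv_trm t = {0}"
proof -
  have fv: "fv_trm ((SndT ^^ j) argsT) = {0}" for j by (induction j) simp_all
  have "wf_trm V D ((SndT ^^ j) argsT)" for j by (induction j) (simp_all add: fv)
  with fv show "length (tupleT r) = r" "t \<in> set (tupleT r) \<Longrightarrow> wf_trm V D t \<and> fv_trm t = {0}"
    by (auto simp: tupleT_def)
qed

lemma bitTs_ok:
  assumes "i < length arity_list"
  shows "wf_trm (\<Upsilon> @ [1]) D (bitTs ! i)" "bool_trm D (bitTs ! i)" "fv_trm (bitTs ! i) \<subseteq> {0}"
proof -
  have "length bitTs = length arity_list" by (simp add: bitTs_def arity_list_def)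
  then have "bitTs ! i \<in> set bitTs" using assms by simp
  moreover have "wf_trm (\<Upsilon> @ [1]) D t \<and> bool_trm D t \<and> fv_trm t \<subseteq> {0}" if t: "t \<in> set bitTs" for t
  proof -
    have "tupleT 2 ! 0 \<in> set (tupleT 2)" "tupleT 2 ! 1 \<in> set (tupleT 2)"
      using tupleT_ok(1)[of 2] by (metis nth_mem pos2, metis nth_mem one_less_numeral_iff semiring_norm(76))
    note two = this[THEN tupleT_ok(2)]
    consider "t = TrueT" | "t = App FalseF []"
      | k where "k < length \<Upsilon>" "t = App (Inp k) (tupleT (\<Upsilon> ! k))"
      | "t = AndT (InT (KP (tupleT 2 ! 0) (tupleT 2 ! 1)) orderT) (NotT (EqT (tupleT 2 ! 0) (tupleT 2 ! 1)))"
      using t unfolding bitTs_def by auto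
    then show ?thesis
    proof cases
      case 3
      have "\<forall>t \<in> set (tupleT (\<Upsilon> ! k)). wf_trm (\<Upsilon> @ [1]) D t \<and> fv_trm t = {0}"
        using tupleT_ok(2) by blast
      with 3 show ?thesis
        by (auto simp: valid_def arity_def relational_def nth_append tupleT_ok(1))
    qed (use two[of "\<Upsilon> @ [1]" D] in \<open>simp_all add: valid_def arity_def relational_def\<close>)
  qed
  ultimately show "wf_trm (\<Upsilon> @ [1]) D (bitTs ! i)" "bool_trm D (bitTs ! i)"
    "fv_trm (bitTs ! i) \<subseteq> {0}" by blast+
qed

lemma rules_ok: "\<rho> \<in> set rules \<Longrightarrow> rule_ok \<rho>"
proof -
  note [simp] = rule_ok_def valid_def arity_def relational_def
  have "rule_ok extend_rule" by (auto simp: extend_rule_def)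
  moreover have "rule_ok ordered_rule" by (auto simp: ordered_rule_def)
  moreover have "rule_ok pop_rule" by (simp add: pop_rule_def)
  moreover have "rule_ok loop_rule" by (auto simp: loop_rule_def)
  moreover have "rule_ok start_rule" by (simp add: start_rule_def)
  moreover have "rule_ok (bit_rule i b)" if "i < length arity_list" for i b
    using bitTs_ok[OF that] by (auto simp: bit_rule_def)
  moreover have "rule_ok (tm_rule p a)" for p a
    by (auto simp: tm_rule_def split: prod.split)
  moreover have "rule_ok (idle_rule p)" for p by (simp add: idle_rule_def)
  ultimately have "\<not> (\<exists>\<rho> \<in> set rules. \<not> rule_ok \<rho>)" unfolding Bex_rules by blast
  then show "\<rho> \<in> set rules \<Longrightarrow> rule_ok \<rho>" by blast
qed

lemma listT_simps [simp]:
  "fv_trm (listT ts) = (\<Union>t \<in> set ts. fv_trm t)"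
  "wf_trm V D (listT ts) \<longleftrightarrow> (\<forall>t \<in> set ts. wf_trm V D t)"
  "val A e (listT ts) = list_obj (map (val A e) ts)"
  by (induction ts) (simp_all add: listT_def valid_def arity_def)

lemma is_program_simulation: "is_program (\<Upsilon> @ [1]) simulation"
proof -
  note [simp] = valid_def arity_def relational_def
  let ?wf = "wf_trm (\<Upsilon> @ [1]) [(0, False)]"
  have confs: "?wf confsT" "fv_trm confsT = {}" by (simp_all add: confsT_def)
  have start: "?wf startT" "fv_trm startT = {}" by (auto simp: startT_def)
  have "?wf (BigUnT (Compr (Compr t 1 r g) 0 confsT TrueT)) \<and>
      fv_trm (BigUnT (Compr (Compr t 1 r g) 0 confsT TrueT)) = {}"
    if "(r, g, t) \<in> set rules" for r g t
    using rules_ok[OF that] confs by (auto simp: rule_ok_def)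
  then have nxt: "?wf nextT" "fv_trm nextT = {}"
    by (auto simp: nextT_def simp del: wf_trm.simps fv_trm.simps)
  show ?thesis
    using confs start nxt
    by (simp add: is_program_def simulation_def main_def acceptingT_def rejectingT_def)
qed

lemma val_confsT [simp]: "val A e confsT = dyn A (Aux 0) []"
  by (simp add: confsT_def val.simps(2) interp_def)

lemma val_nextT:
  "fset (elems (val A (\<lambda>_. ff) nextT)) = (\<Union>c \<in> fset (elems (dyn A (Aux 0) [])). next_objs A c)"
proof (rule set_eqI)
  fix c'
  have "c' |\<in>| elems (val A (\<lambda>_. ff)
        (case \<rho> of (r, g, t) \<Rightarrow> BigUnT (Compr (Compr t 1 r g) 0 confsT TrueT))) \<longleftrightarrow>
      (\<exists>c. c |\<in>| elems (dyn A (Aux 0) []) \<and> fires A \<rho> c c')" for \<rho>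
  proof (cases \<rho>)
    case (fields r g t)
    then show ?thesis
      unfolding fires_def fields prod.case val_BigUnT elems_big_union val_Compr val_confsT
      using tru_simps(4) val_Compr[of c' A _ t 1 r g] by blast
  qed
  then show "c' |\<in>| elems (val A (\<lambda>_. ff) nextT) \<longleftrightarrow>
      c' \<in> (\<Union>c \<in> fset (elems (dyn A (Aux 0) [])). next_objs A c)"
    unfolding nextT_def val_UnionsT next_objs_def by auto
qed

lemma sequel_single:
  assumes "den R A (\<lambda>_. ff) = {(f, [], b)}"
  shows "sequel R A = A\<lparr>dyn := \<lambda>g xs. if g = f \<and> xs = [] then b else dyn A g xs\<rparr>"
proof -
  have "\<not> clash {(f, [], b)}" by (auto simp: clash_def)
  moreover have "(if \<exists>b'. (g, xs, b') \<in> {(f, [], b)} then THE b'. (g, xs, b') \<in> {(f, [], b)}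
      else dyn A g xs) = (if g = f \<and> xs = [] then b else dyn A g xs)" for g and xs :: "obj list"
    by auto
  ultimately show ?thesis by (simp only: sequel_def assms apply_updates_def Let_def if_False)
qed

definition finished :: "obj \<Rightarrow> bool" where
  "finished c \<longleftrightarrow> ofst c = num (tm_accept M + 2) \<or> ofst c = num (tm_reject M + 2)"

lemma tru_halting:
  "tru A e (ExT 0 confsT (NotT (OrT acceptingT rejectingT))) \<longleftrightarrow>
     (\<exists>c. c |\<in>| elems (dyn A (Aux 0) []) \<and> \<not> finished c)"
  by (simp add: acceptingT_def rejectingT_def finished_def)

lemma tru_accepting:
  "tru A e (ExT 0 confsT acceptingT) \<longleftrightarrow>
     (\<exists>c. c |\<in>| elems (dyn A (Aux 0) []) \<and> ofst c = num (tm_accept M + 2))"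
  by (simp add: acceptingT_def)

end

section \<open>The three kinds of moves: setting up, stepping, halting\<close>

context order_simulation_on
begin

definition conf_state :: "obj fset \<Rightarrow> state" where
  "conf_state Y = \<lparr>input = S, dyn = (\<lambda>f xs. if f = Aux 0 \<and> xs = [] then HSet Y else ff)\<rparr>"

definition final_state :: "obj fset \<Rightarrow> bool \<Rightarrow> state" where
  "final_state Y b = \<lparr>input = S, dyn = (\<lambda>f xs. if f = Aux 0 \<and> xs = [] then HSet Y
     else if f = Halt \<and> xs = [] then tt else if f = Output \<and> xs = [] then bool_obj b else ff)\<rparr>"

lemma conf_state_simps [simp]: "input (conf_state Y) = S" "dyn (conf_state Y) (Aux 0) [] = HSet Y"
  by (simp_all add: conf_state_def)

definition start :: conf where "start = (0, {||}, agenda (length arity_list), [], [])"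

lemma val_startT:
  assumes "input A = S"
  shows "val A e startT = conf_obj start"
proof -
  have "order_obj {||} = ff" by (simp add: order_obj_def ff_def)
  then show ?thesis
    using val_uT[OF assms]
    by (simp add: startT_def start_def confT_def frameT_def agenda_def o_def rev_map)
qed

text \<open>An empty value of \<open>Aux 0\<close> is what marks the initial state; the families
  that follow are never empty within the run.\<close>

lemma sequel_initial: "sequel main (initial_state S) = conf_state {|conf_obj start|}"
proof -
  let ?A = "initial_state S"
  have A: "input ?A = S" "dyn ?A f xs = ff" for f xs by (simp_all add: initial_state_def)
  have "tru ?A (\<lambda>_. ff) (EqT confsT EmptyT)" by (simp add: A)
  then have "den main ?A (\<lambda>_. ff) = {(Aux 0, [], HSet {|conf_obj start|})}"
    by (simp add: main_def tru_def val_startT A(1))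
  from sequel_single[OF this] show ?thesis
    by (simp add: conf_state_def initial_state_def fun_eq_iff)
qed

lemma sequel_next:
  assumes "c |\<in>| Y" "\<not> finished c"
  shows "sequel main (conf_state Y) =
    conf_state (elems (val (conf_state Y) (\<lambda>_. ff) nextT))"
proof -
  let ?A = "conf_state Y"
  have "\<not> tru ?A (\<lambda>_. ff) (EqT confsT EmptyT)"
    using assms(1) by (auto simp: ff_def)
  moreover have "tru ?A (\<lambda>_. ff) (ExT 0 confsT (NotT (OrT acceptingT rejectingT)))"
    unfolding tru_halting using assms by auto
  \<comment> \<open>The new value must be a set and not an atom, so that wrapping its elements in
    \<open>HSet\<close> gives it back.\<close>
  moreover have "\<exists>s. val ?A (\<lambda>_. ff) nextT = HSet s"
    by (cases rules) (auto simp: nextT_def big_union_def ff_def)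
  ultimately have "den main ?A (\<lambda>_. ff) =
      {(Aux 0, [], HSet (elems (val ?A (\<lambda>_. ff) nextT)))}"
    by (auto simp: main_def tru_def)
  from sequel_single[OF this] show ?thesis by (simp add: conf_state_def fun_eq_iff)
qed

lemma sequel_final:
  assumes "Y \<noteq> {||}" "\<And>c. c |\<in>| Y \<Longrightarrow> finished c"
  shows "sequel main (conf_state Y) =
    final_state Y (\<exists>c. c |\<in>| Y \<and> ofst c = num (tm_accept M + 2))"
proof -
  let ?A = "conf_state Y" and ?b = "\<exists>c. c |\<in>| Y \<and> ofst c = num (tm_accept M + 2)"
  have 1: "\<not> tru ?A (\<lambda>_. ff) (EqT confsT EmptyT)" using assms(1) by (auto simp: ff_def)
  have 2: "\<not> tru ?A (\<lambda>_. ff) (ExT 0 confsT (NotT (OrT acceptingT rejectingT)))"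
    unfolding tru_halting using assms(2) by auto
  have one: "HSet {|ff|} \<noteq> ff" by (simp add: ff_def)
  have 3: "val ?A e (ExT 0 confsT acceptingT) = bool_obj ?b" for e
    using tru_accepting[of ?A e] static_bool[OF static_ExT, of ?A e 0 confsT acceptingT]
    by (auto simp: tru_def is_bool_def bool_obj_def)
  have 4: "val ?A e (EqT (Var 0) EmptyT) = tt \<longleftrightarrow> e 0 = ff" for e
    using tru_simps(1)[of ?A e "Var 0" EmptyT] by (simp add: tru_def)
  have 5: "val ?A e TrueT = tt" for e using tru_simps(4) by (simp add: tru_def)
  have den: "den main ?A (\<lambda>_. ff) = {(Halt, [], tt), (Output, [], bool_obj ?b)}"
    using 1 2 one by (auto simp: main_def tru_def[symmetric] 3)
      (auto simp: tru_def 4 5 3)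
  have the: "(THE b. f = Halt \<and> xs = [] \<and> b = tt \<or> f = Output \<and> xs = [] \<and> b = bool_obj ?b) =
      (if f = Halt then tt else bool_obj ?b)" if "f = Halt \<or> f = Output" "xs = []" for f and xs :: "obj list"
    using that by auto
  show ?thesis
    unfolding sequel_def Let_def den
    by (auto simp: clash_def apply_updates_def conf_state_def final_state_def fun_eq_iff)
qed

end

section \<open>The sets of configurations\<close>

context order_simulation_on
begin

primrec family :: "nat \<Rightarrow> obj fset" where
  "family 0 = {|conf_obj start|}"
| "family (Suc k) = elems (val (conf_state (family k)) (\<lambda>_. ff) nextT)"

lemma fset_family_Suc:
  "fset (family (Suc k)) = (\<Union>c \<in> fset (family k). next_objs (conf_state (family k)) c)"
  by (simp add: val_nextT)

text \<open>Besides listing the possible members, nonemptiness is carried along: it keeps the run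
  from starting afresh and later provides a configuration that shows the verdict.\<close>

lemma ex_chain_conf:
  assumes "k \<le> m"
  shows "family k \<noteq> {||} \<and> (\<forall>c. c |\<in>| family k \<longrightarrow>
    (\<exists>zs. distinct zs \<and> set zs \<subseteq> U_set \<Upsilon> S \<and> length zs = k \<and>
       c = conf_obj (0, chain_order zs, agenda (length arity_list), [], [])))"
  using assms
proof (induction k)
  case 0
  then show ?case by (auto simp: start_def)
next
  case (Suc k)
  let ?ag = "agenda (length arity_list)"
  let ?A = "conf_state (family k)"
  have succ: "\<exists>x. x \<in> U_set \<Upsilon> S - set zs"
    and next_iff: "c' \<in> next_objs ?A (conf_obj (0, chain_order zs, ?ag, [], [])) \<longleftrightarrow>
      (\<exists>x \<in> U_set \<Upsilon> S - set zs. c' = conf_obj (0, chain_order (x # zs), ?ag, [], []))"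
    if zs: "distinct zs" "set zs \<subseteq> U_set \<Upsilon> S" "length zs = k" for zs c'
  proof -
    have "card (set zs) < m" using zs Suc.prems by (simp add: distinct_card)
    then show ex: "\<exists>x. x \<in> U_set \<Upsilon> S - set zs"
      by (meson DiffI card_mono finite_set not_le subsetI)
    have eq: "chain_order zs |\<union>| (\<lambda>y. (y, x)) |`| ffilter (\<lambda>y. (y, y) |\<in>| chain_order zs \<or> y = x) U =
        chain_order (x # zs)" if "x \<in> U_set \<Upsilon> S" for x
    proof -
      have "ffilter (\<lambda>y. (y, y) |\<in>| chain_order zs \<or> y = x) U = fset_of_list (x # zs)"
        by (rule fset_eqI) (use that zs(2) in \<open>auto simp: fset_of_list_elem fmember_U\<close>)
      then show ?thesis by (simp only: chain_order.simps(2))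
    qed
    \<comment> \<open>An element not yet placed blocks \<open>ordered_rule\<close>, so only
      \<open>extend_rule\<close> can fire before all of \<open>U\<close> is placed.\<close>
    have "\<not> (\<forall>x. x |\<in>| U \<longrightarrow> (x, x) |\<in>| chain_order zs)" using ex by (auto simp: fmember_U)
    then have "c' \<in> next_objs ?A (conf_obj (0, chain_order zs, ?ag, [], [])) \<longleftrightarrow>
        fires ?A extend_rule (conf_obj (0, chain_order zs, ?ag, [], [])) c'"
      by (auto simp: fires_simps simp del: conf_obj.simps dest!: fires_tm_tag)
    then show "c' \<in> next_objs ?A (conf_obj (0, chain_order zs, ?ag, [], [])) \<longleftrightarrow>
      (\<exists>x \<in> U_set \<Upsilon> S - set zs. c' = conf_obj (0, chain_order (x # zs), ?ag, [], []))"
      using eq by (auto simp: fires_extend simp del: conf_obj.simps)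
  qed
  have IH: "family k \<noteq> {||}" "\<And>c. c |\<in>| family k \<Longrightarrow> \<exists>zs. distinct zs \<and> set zs \<subseteq> U_set \<Upsilon> S \<and>
      length zs = k \<and> c = conf_obj (0, chain_order zs, ?ag, [], [])"
    using Suc by auto
  show ?case
  proof (intro conjI allI impI)
    obtain c zs where "c |\<in>| family k" and zs: "distinct zs" "set zs \<subseteq> U_set \<Upsilon> S" "length zs = k"
      "c = conf_obj (0, chain_order zs, ?ag, [], [])" using IH by (metis ex_fin_conv)
    moreover obtain x where "x \<in> U_set \<Upsilon> S - set zs" using succ[OF zs(1-3)] by blast
    ultimately have "conf_obj (0, chain_order (x # zs), ?ag, [], []) \<in> fset (family (Suc k))"
      unfolding fset_family_Suc using next_iff[OF zs(1-3)] by blast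
    then show "family (Suc k) \<noteq> {||}" by (metis fempty_iff)
  next
    fix c' assume "c' |\<in>| family (Suc k)"
    then obtain c where c: "c |\<in>| family k" "c' \<in> next_objs ?A c" unfolding fset_family_Suc by blast
    then obtain zs where zs: "distinct zs" "set zs \<subseteq> U_set \<Upsilon> S" "length zs = k"
      "c = conf_obj (0, chain_order zs, ?ag, [], [])" using IH(2) by blast
    then obtain x where "x \<in> U_set \<Upsilon> S - set zs" "c' = conf_obj (0, chain_order (x # zs), ?ag, [], [])"
      using c(2) next_iff[OF zs(1-3)] by blast
    then show "\<exists>zs. distinct zs \<and> set zs \<subseteq> U_set \<Upsilon> S \<and> length zs = Suc k \<and>
        c' = conf_obj (0, chain_order zs, ?ag, [], [])"
      using zs by (intro exI[of _ "x # zs"]) auto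
  qed
qed

text \<open>There are \<open>m! / (m - k)!\<close> lists of \<open>k\<close> distinct elements, a
  divisor of \<open>m!\<close>.\<close>

lemma card_chains:
  assumes "k \<le> m"
  shows "card (fset (family k)) \<le> fact m"
proof -
  let ?L = "{zs. length zs = k \<and> distinct zs \<and> set zs \<subseteq> U_set \<Upsilon> S}"
  have "card ?L = \<Prod>{m - k + 1..m}"
    by (rule card_lists_distinct_length_eq[OF finite_U_set assms])
  also have "\<dots> \<le> \<Prod>{1..m}"
    by (rule dvd_imp_le[OF prod_dvd_prod_subset]) (auto intro: prod_pos)
  finally have L: "card ?L \<le> fact m" by (simp add: fact_prod)
  have "finite ?L"
    by (rule finite_subset[OF _ finite_lists_length_eq[OF finite_U_set, of k]]) auto
  moreover have "fset (family k) \<subseteq>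
      (\<lambda>zs. conf_obj (0, chain_order zs, agenda (length arity_list), [], [])) ` ?L"
    using ex_chain_conf[OF assms] by blast
  ultimately show ?thesis using L by (meson card_image_le card_mono finite_imageI order_trans)
qed

text \<open>At most \<open>m * m\<close> pairs of the order weigh 5 each, and an initial frame
  without arguments weighs 14 plus its labels and \<open>m\<close>, with 3 more for its place in the
  list.\<close>

definition initial_weight :: nat where
  "initial_weight = 17 + 5 * (m * m) + (\<Sum>i<length arity_list. 17 + i + arity_list ! i + m)"

definition bound :: "nat \<Rightarrow> nat" where
  "bound n = 1 + fact m * (initial_weight + duration n * growth)"

lemma weight_chain:
  assumes "set zs \<subseteq> U_set \<Upsilon> S"
  shows "weight (0, chain_order zs, agenda (length arity_list), [], []) \<le> initial_weight"
proof -
  have "(\<Sum>f \<leftarrow> agenda (length arity_list). 3 + frame_weight f) =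
      (\<Sum>i \<leftarrow> [0..<length arity_list]. 17 + i + arity_list ! i + m)"
    by (simp add: agenda_def rev_map[symmetric] o_def fcard.rep_eq add.assoc)
  also have "\<dots> = (\<Sum>i<length arity_list. 17 + i + arity_list ! i + m)"
    by (simp only: interv_sum_list_conv_sum_set_nat set_upt atLeast0LessThan)
  finally show ?thesis
    using fcard_chain_order[OF assms finite_U_set] by (simp add: initial_weight_def)
qed

lemma halting_trace: "(c, c') \<in> det ^^ n \<Longrightarrow> halting c \<Longrightarrow> fst c' = fst c"
proof (induction n arbitrary: c)
  case (Suc n)
  then obtain d where "(c, d) \<in> det" "(d, c') \<in> det ^^ n" by (meson relpow_Suc_D2)
  moreover from this(1) Suc.prems(2) have "fst d = fst c" by (simp add: det_def)
  ultimately show ?case using Suc by (simp add: halting_def)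
qed simp

lemma finished_conf_obj [simp]: "finished (conf_obj c) \<longleftrightarrow> halting c"
  by (cases c) (simp add: finished_def halting_def)

context
  fixes n :: nat and b :: bool
  assumes verdict: "\<And>zs. distinct zs \<Longrightarrow> set zs = U_set \<Upsilon> S \<Longrightarrow>
    tm_state_at M (encoding (\<Upsilon> @ [2]) (ordered zs)) n = (if b then tm_accept M else tm_reject M)"
begin

text \<open>Each member has exactly one successor, so the number of members cannot grow any more.
  The remaining trace to the verdict serves as a countdown: it loses one step whenever
  \<open>k\<close> grows by one.\<close>

lemma family_after:
  assumes "k \<le> duration n"
  shows "family (m + k) \<noteq> {||} \<and> card (fset (family (m + k))) \<le> fact m \<and>
    (\<forall>x. x |\<in>| family (m + k) \<longrightarrow> (\<exists>c c'. x = conf_obj c \<and>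
       weight c \<le> initial_weight + k * growth \<and> (c, c') \<in> det ^^ (duration n - k) \<and>
       fst c' = (if b then tm_accept M else tm_reject M) + 2))"
  using assms
proof (induction k)
  case 0
  have "\<exists>c c'. x = conf_obj c \<and>
       weight c \<le> initial_weight + 0 * growth \<and> (c, c') \<in> det ^^ (duration n - 0) \<and>
       fst c' = (if b then tm_accept M else tm_reject M) + 2" if x: "x |\<in>| family m" for x
  proof -
    obtain zs where zs: "distinct zs" "set zs \<subseteq> U_set \<Upsilon> S" "length zs = m"
      "x = conf_obj (0, chain_order zs, agenda (length arity_list), [], [])"
      using ex_chain_conf[of m] x by blast
    have "set zs = U_set \<Upsilon> S"
      using zs(1-3) by (intro card_subset_eq[OF finite_U_set]) (simp_all add: distinct_card)
    from trace_ordered[OF zs(1) this, of n] verdict[OF zs(1) this] obtain c' where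
      "((0, chain_order zs, agenda (length arity_list), [], []), c') \<in> det ^^ duration n"
      "fst c' = (if b then tm_accept M else tm_reject M) + 2" by auto
    then show ?thesis using weight_chain[OF zs(2)] unfolding zs(4)
      by (intro exI[of _ "(0, chain_order zs, agenda (length arity_list), [], [])"] exI[of _ c']) simp
  qed
  then show ?case using ex_chain_conf[of m] card_chains[of m] by simp
next
  case (Suc k)
  let ?F = "family (m + k)" and ?A = "conf_state (family (m + k))"
  note IH = Suc.IH[OF Suc_leD[OF Suc.prems]]
  have nxt: "\<exists>c c'. next_objs ?A x = {conf_obj c} \<and>
       weight c \<le> initial_weight + Suc k * growth \<and> (c, c') \<in> det ^^ (duration n - Suc k) \<and>
       fst c' = (if b then tm_accept M else tm_reject M) + 2" if x: "x |\<in>| ?F" for x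
  proof -
    obtain c c' where c: "x = conf_obj c" "weight c \<le> initial_weight + k * growth"
      "(c, c') \<in> det ^^ (duration n - k)" "fst c' = (if b then tm_accept M else tm_reject M) + 2"
      using IH x by blast
    have "duration n - k = Suc (duration n - Suc k)" using Suc.prems by simp
    then obtain d where d: "(c, d) \<in> det" "(d, c') \<in> det ^^ (duration n - Suc k)"
      using c(3) by (metis relpow_Suc_D2)
    have "next_objs ?A x = {conf_obj d}" "weight d \<le> weight c + growth"
      using d(1) unfolding det_def c(1) by auto
    then show ?thesis using c(2,4) d(2) by (intro exI[of _ d] exI[of _ c']) simp
  qed
  have eq: "fset (family (m + Suc k)) = (\<Union>x \<in> fset ?F. next_objs ?A x)"
    using fset_family_Suc[of "m + k"] by simp
  have "card (next_objs ?A x) = 1" if "x |\<in>| ?F" for x using nxt[OF that] by auto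
  then have "card (fset (family (m + Suc k))) \<le> (\<Sum>x \<in> fset ?F. 1)"
    unfolding eq by (intro order_trans[OF card_UN_le] sum_mono) auto
  moreover have "family (m + Suc k) \<noteq> {||}"
  proof -
    obtain x where "x |\<in>| ?F" using IH by auto
    then obtain c where "next_objs ?A x = {c}" using nxt by blast
    then have "c \<in> fset (family (m + Suc k))" unfolding eq using \<open>x |\<in>| ?F\<close> by blast
    then show ?thesis by (metis fempty_iff)
  qed
  moreover have "\<exists>c c'. x = conf_obj c \<and>
       weight c \<le> initial_weight + Suc k * growth \<and> (c, c') \<in> det ^^ (duration n - Suc k) \<and>
       fst c' = (if b then tm_accept M else tm_reject M) + 2" if "x |\<in>| family (m + Suc k)" for x
    using that nxt unfolding eq by fastforce
  ultimately show ?case using IH by auto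
qed

lemma family_bounds:
  assumes "k \<le> m + duration n"
  shows "family k \<noteq> {||}" "card (TC (HSet (family k))) \<le> bound n"
proof -
  have *: "family k \<noteq> {||} \<and> card (fset (family k)) \<le> fact m \<and> (\<forall>x. x |\<in>| family k \<longrightarrow>
    (\<exists>c. x = conf_obj c \<and> weight c \<le> initial_weight + duration n * growth))"
  proof (cases "k \<le> m")
    case True
    then show ?thesis using ex_chain_conf card_chains weight_chain by (metis trans_le_add1)
  next
    case False
    then obtain i where i: "k = m + i" "i \<le> duration n"
      using assms by (metis le_add_diff_inverse linear add_le_cancel_left)
    then have "i * growth \<le> duration n * growth" by simp
    then show ?thesis using family_after[OF i(2)] unfolding i(1) by (meson add_left_mono order_trans)
  qed
  then show "family k \<noteq> {||}" by blast
  have "card (TC x) \<le> initial_weight + duration n * growth" if "x |\<in>| family k" for x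
    using * that card_TC_conf_obj order_trans by blast
  then have "(\<Sum>x \<in> fset (family k). card (TC x)) \<le>
      card (fset (family k)) * (initial_weight + duration n * growth)"
    using sum_bounded_above[of "fset (family k)" "\<lambda>x. card (TC x)"] by simp
  also have "\<dots> \<le> fact m * (initial_weight + duration n * growth)"
    using * by (intro mult_right_mono) auto
  finally show "card (TC (HSet (family k))) \<le> bound n"
    using card_TC_HSet[of "family k"] by (simp add: bound_def)
qed

text \<open>At the first time \<open>t\<close> when all members have halted, their traces may still
  be unfinished; since halting tags never change, the tags at \<open>t\<close> are already those at
  the ends of the traces. This uses \<open>m \<le> t\<close>, which holds because the earlier
  families are nonempty and carry the non-halting tag 0.\<close>

lemma ex_finish:
  obtains t where "t \<le> m + duration n" "\<And>k. k < t \<Longrightarrow> \<exists>c. c |\<in>| family k \<and> \<not> finished c"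
    "\<And>c. c |\<in>| family t \<Longrightarrow> finished c"
    "(\<exists>c. c |\<in>| family t \<and> ofst c = num (tm_accept M + 2)) \<longleftrightarrow> b"
proof -
  let ?P = "\<lambda>k. \<forall>c. c |\<in>| family k \<longrightarrow> finished c"
  let ?v = "(if b then tm_accept M else tm_reject M) + 2"
  have P: "?P (m + duration n)"
  proof (intro allI impI)
    fix x assume "x |\<in>| family (m + duration n)"
    then obtain c c' where "x = conf_obj c" "(c, c') \<in> det ^^ (duration n - duration n)" "fst c' = ?v"
      using family_after[OF order_refl] by blast
    then show "finished x" by (simp add: halting_def del: conf_obj.simps)
  qed
  define t where "t = (LEAST k. ?P k)"
  have t: "?P t" "t \<le> m + duration n" and less: "\<And>k. k < t \<Longrightarrow> \<not> ?P k"
    unfolding t_def using LeastI[of ?P, OF P] Least_le[of ?P, OF P] not_less_Least[of _ ?P] by blast+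
  have "m \<le> t"
  proof (rule ccontr)
    assume "\<not> m \<le> t"
    then obtain c zs where "c |\<in>| family t"
      "c = conf_obj (0, chain_order zs, agenda (length arity_list), [], [])"
      using ex_chain_conf[of t] by (metis ex_fin_conv nat_le_linear)
    then show False using t(1) by (auto simp: halting_def simp del: conf_obj.simps)
  qed
  then obtain i where i: "t = m + i" "i \<le> duration n"
    using t(2) by (metis le_add_diff_inverse add_le_cancel_left)
  have tag: "ofst x = num ?v" if x: "x |\<in>| family t" for x
  proof -
    obtain c c' where c: "x = conf_obj c" "(c, c') \<in> det ^^ (duration n - i)" "fst c' = ?v"
      using family_after[OF i(2)] x unfolding i(1) by blast
    moreover have "halting c" using t(1) x c(1) by (auto simp del: conf_obj.simps)
    ultimately have "fst c = ?v" using halting_trace by metis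
    then show ?thesis unfolding c(1) by (cases c) simp
  qed
  have "tm_accept M \<noteq> tm_reject M" using tm by (simp add: is_tm_def)
  moreover have "\<exists>c. c |\<in>| family t" using family_bounds(1)[OF t(2)] by auto
  ultimately have "(\<exists>c. c |\<in>| family t \<and> ofst c = num (tm_accept M + 2)) \<longleftrightarrow> b"
    using tag by (auto split: if_splits)
  with t less show ?thesis by (intro that) auto
qed

lemma card_active:
  assumes "input A = S" and "critical A \<subseteq> Atom ` universe S \<union> {ff, tt} \<union> {HSet Y}"
    and "card (TC (HSet Y)) \<le> bound n"
  shows "finite (active A) \<and> card (active A) \<le> card (universe S) + 2 + bound n"
proof -
  have "TC ff = {ff}" "TC tt \<subseteq> {ff, tt}"
    using TC_HSet[of "{||}"] TC_HSet[of "{|ff|}"] TC.self[of ff] by (auto simp: ff_def tt_def)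
  then have sub: "active A \<subseteq> (Atom ` universe S \<union> {ff, tt}) \<union> TC (HSet Y)"
    using assms(2) by (auto simp: active_def TC_Atom)
  have fin: "finite (universe S)" using struct by (simp add: is_struct_def)
  have "card (active A) \<le> card ((Atom ` universe S \<union> {ff, tt}) \<union> TC (HSet Y))"
    by (rule card_mono[OF _ sub]) (simp add: fin finite_TC)
  also have "\<dots> \<le> card (Atom ` universe S \<union> {ff, tt}) + card (TC (HSet Y))"
    by (rule card_Un_le)
  also have "card (Atom ` universe S \<union> {ff, tt}) \<le> card (universe S) + 2"
    using card_Un_le[of "Atom ` universe S" "{ff, tt}"] card_image_le[OF fin, of Atom]
    by simp
  finally have "card (active A) \<le> card (universe S) + 2 + bound n" using assms(3) by simp
  moreover have "finite (active A)" by (rule finite_subset[OF sub]) (simp add: fin finite_TC)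
  ultimately show ?thesis by blast
qed

text \<open>The family of index \<open>k\<close> is reached after \<open>k + 1\<close> steps, as one
  step sets up the first family; one more step sets \<open>Halt\<close> and \<open>Output\<close>.
  This gives the 2.\<close>

lemma simulation_run:
  "\<exists>l. l \<le> m + duration n + 2 \<and> run_reaches simulation S l \<and>
    halted (run_state simulation S l) \<and>
    dyn (run_state simulation S l) Output [] = bool_obj b \<and>
    (\<forall>i \<le> l. finite (active (run_state simulation S i)) \<and>
       card (active (run_state simulation S i)) \<le> card (universe S) + 2 + bound n)"
proof -
  obtain t where t: "t \<le> m + duration n" "\<And>k. k < t \<Longrightarrow> \<exists>c. c |\<in>| family k \<and> \<not> finished c"
    "\<And>c. c |\<in>| family t \<Longrightarrow> finished c"
    "(\<exists>c. c |\<in>| family t \<and> ofst c = num (tm_accept M + 2)) \<longleftrightarrow> b"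
    using ex_finish by blast
  have run: "run_state simulation S (Suc k) = conf_state (family k)" if "k \<le> t" for k
    using that
  proof (induction k)
    case 0
    then show ?case by (simp add: run_state_def simulation_def sequel_initial)
  next
    case (Suc k)
    then obtain c where "c |\<in>| family k" "\<not> finished c" using t(2)[of k] by auto
    from sequel_next[OF this] Suc show ?case by (simp add: run_state_def simulation_def)
  qed
  have fin: "run_state simulation S (t + 2) = final_state (family t) b"
    using sequel_final[of "family t", OF family_bounds(1)[OF t(1)] t(3)] t(4) run[of t]
    by (simp add: run_state_def simulation_def)
  have cases: "i = 0 \<or> (\<exists>k \<le> t. i = Suc k) \<or> i = t + 2" if "i \<le> t + 2" for i
    using that by (cases i) auto
  show ?thesis
  proof (intro exI[of _ "t + 2"] conjI allI impI)
    show "t + 2 \<le> m + duration n + 2" using t(1) by simp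
    have "\<not> halted (run_state simulation S i)" if "i < t + 2" for i
      using cases[of i] that run
      by (auto simp: halted_def conf_state_def) (simp add: run_state_def initial_state_def)
    then show "run_reaches simulation S (t + 2)" by (simp add: run_reaches_def)
    show "halted (run_state simulation S (t + 2))"
      "dyn (run_state simulation S (t + 2)) Output [] = bool_obj b"
      by (simp_all only: fin) (simp_all add: halted_def final_state_def)
    have "finite (active (run_state simulation S i)) \<and>
       card (active (run_state simulation S i)) \<le> card (universe S) + 2 + bound n" if "i \<le> t + 2" for i
    proof -
      from that consider "i = 0" | k where "k \<le> t" "i = Suc k" | "i = t + 2" using cases by blast
      then show ?thesis
      proof cases
        case 1
        then show ?thesis
          using family_bounds(2)[of 0]
          by (intro card_active[of _ "family 0"])
            (auto simp: run_state_def initial_state_def critical_def)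
      next
        case 2
        then show ?thesis
          unfolding 2(2) run[OF 2(1)] using family_bounds(2)[of k] t(1)
          by (intro card_active[of _ "family k"]) (auto simp: conf_state_def critical_def split: if_splits)
      next
        case 3
        then show ?thesis
          unfolding 3 fin using family_bounds(2)[of t] t(1)
          by (intro card_active[of _ "family t"])
            (auto simp: final_state_def critical_def bool_obj_def split: if_splits)
      qed
    qed
    then show "finite (active (run_state simulation S i))"
      "card (active (run_state simulation S i)) \<le> card (universe S) + 2 + bound n" if "i \<le> t + 2" for i
      using that by blast+
  qed
qed

end
end

section \<open>Polynomial bounds\<close>

text \<open>Natural coefficients make the bounding polynomials monotone. This is what allows
  composition, and replacing \<open>|U|\<close> by the larger \<open>|A|\<close>.\<close>

definition poly_bounded :: "(nat \<Rightarrow> nat) \<Rightarrow> bool" where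
  "poly_bounded f \<longleftrightarrow> (\<exists>p :: nat poly. \<forall>n. f n \<le> poly p n)"

lemma poly_nat_mono: "(x :: nat) \<le> y \<Longrightarrow> poly p x \<le> poly p y"
  by (induction p) (auto intro!: add_mono mult_mono)

lemma poly_boundedI: "(\<And>n. f n \<le> poly p n) \<Longrightarrow> poly_bounded f"
  by (auto simp: poly_bounded_def)

lemma poly_bounded_const [intro]: "poly_bounded (\<lambda>_. c)"
  by (rule poly_boundedI[of _ "[:c:]"]) simp

lemma poly_bounded_id [intro]: "poly_bounded (\<lambda>n. n)"
  by (rule poly_boundedI[of _ "[:0, 1:]"]) simp

lemma poly_bounded_add [intro]:
  assumes "poly_bounded f" "poly_bounded g"
  shows "poly_bounded (\<lambda>n. f n + g n)"
proof -
  obtain p q where "\<And>n. f n \<le> poly p n" "\<And>n. g n \<le> poly q n"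
    using assms by (auto simp: poly_bounded_def)
  then show ?thesis by (intro poly_boundedI[of _ "p + q"]) (simp add: add_mono)
qed

lemma poly_bounded_mult [intro]:
  assumes "poly_bounded f" "poly_bounded g"
  shows "poly_bounded (\<lambda>n. f n * g n)"
proof -
  obtain p q where "\<And>n. f n \<le> poly p n" "\<And>n. g n \<le> poly q n"
    using assms by (auto simp: poly_bounded_def)
  then show ?thesis by (intro poly_boundedI[of _ "p * q"]) (simp add: mult_mono)
qed

lemma poly_bounded_power [intro]: "poly_bounded f \<Longrightarrow> poly_bounded (\<lambda>n. f n ^ k)"
  by (induction k) (simp_all add: poly_bounded_const poly_bounded_mult)

lemma poly_bounded_sum [intro]:
  "(\<And>i. i < k \<Longrightarrow> poly_bounded (f i)) \<Longrightarrow> poly_bounded (\<lambda>n. \<Sum>i<(k :: nat). f i n)"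
  by (induction k) auto

lemma poly_bounded_sum_list [intro]:
  "(\<And>a. poly_bounded (f a)) \<Longrightarrow> poly_bounded (\<lambda>n. \<Sum>a \<leftarrow> as. f a n)"
  by (induction as) auto

lemma poly_bounded_poly [intro]:
  assumes "poly_bounded f"
  shows "poly_bounded (\<lambda>n. poly p (f n))"
proof -
  obtain q where "\<And>n. f n \<le> poly q n" using assms by (auto simp: poly_bounded_def)
  then show ?thesis
    by (intro poly_boundedI[of _ "pcompose p q"]) (simp add: poly_pcompose poly_nat_mono)
qed

lemma poly_bounded_cost [intro]: "poly_bounded (cost d)"
proof (induction d)
  case (Suc d)
  have "cost (Suc d) = (\<lambda>n. 1 + n * (1 + cost d n))" by auto
  moreover have "poly_bounded \<dots>" using Suc by (intro poly_bounded_add poly_bounded_mult) auto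
  ultimately show ?case by simp
qed (simp add: poly_bounded_const)

lemma poly_map_int: "poly (map_poly int p) (int n) = int (poly p n)"
  by (induction p) (simp_all add: map_poly_pCons)

lemma poly_bounded_int:
  assumes "poly_bounded f"
  shows "\<exists>p :: int poly. \<forall>m n. m \<le> n \<longrightarrow> int (f m) \<le> poly p (int n)"
proof -
  obtain q where q: "\<And>n. f n \<le> poly q n" using assms by (auto simp: poly_bounded_def)
  have "int (f m) \<le> poly (map_poly int q) (int n)" if "m \<le> n" for m n
    using order_trans[OF q poly_nat_mono[OF that, of q]] by (simp add: poly_map_int)
  then show ?thesis by blast
qed

section \<open>Stability of the verdict of a halted machine\<close>

lemma tm_halt_stays:
  assumes "tm_state_at M s t \<in> {tm_accept M, tm_reject M}"
  shows "tm_state_at M s (k + t) = tm_state_at M s t"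
proof -
  obtain q h tape where c: "(tm_step M ^^ t) (tm_init s) = (q, h, tape)" by (metis prod_cases3)
  have "(tm_step M ^^ k) (q, h, tape) = (q, h, tape)"
    using assms c by (induction k) (auto simp: tm_state_at_def tm_step_def)
  then show ?thesis by (simp add: tm_state_at_def funpow_add c)
qed

lemma tm_state_verdict:
  assumes "is_tm M" "tm_state_at M s n \<in> {tm_accept M, tm_reject M}"
  shows "tm_state_at M s n = (if tm_accepts M s then tm_accept M else tm_reject M)"
proof (cases "tm_accepts M s")
  case True
  then obtain t where "tm_state_at M s t = tm_accept M" by (auto simp: tm_accepts_def)
  then show ?thesis
    using tm_halt_stays[of M s t n] tm_halt_stays[OF assms(2), of t] True by (simp add: add.commute)
next
  case False
  then show ?thesis using assms(2) by (auto simp: tm_accepts_def)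
qed

theorem theorem7:
  fixes \<Upsilon>\<^sub>0 :: vocabulary and j :: nat and K\<^sub>0 :: "fin_struct set"
  assumes "0 < j" and "ptime_class \<Upsilon>\<^sub>0 K\<^sub>0"
  defines "K \<equiv> {A. is_struct (\<Upsilon>\<^sub>0 @ [1]) A \<and>
                   fact (card (universe (U_part \<Upsilon>\<^sub>0 A))) \<le> card (universe A) ^ j}"
  shows "\<exists>P. is_ptime_program (\<Upsilon>\<^sub>0 @ [1]) P \<and>
    (\<forall>A \<in> K. (U_part \<Upsilon>\<^sub>0 A \<in> K\<^sub>0 \<longrightarrow> accepts P A) \<and> (U_part \<Upsilon>\<^sub>0 A \<notin> K\<^sub>0 \<longrightarrow> rejects P A))"
proof -
  obtain M where K\<^sub>0: "\<And>B. B \<in> K\<^sub>0 \<Longrightarrow> is_struct \<Upsilon>\<^sub>0 B"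
      "\<And>B C. B \<in> K\<^sub>0 \<Longrightarrow> is_struct \<Upsilon>\<^sub>0 C \<Longrightarrow> iso B C \<Longrightarrow> C \<in> K\<^sub>0"
    and M: "is_tm M" "tm_polytime M" "\<And>s. tm_accepts M s \<longleftrightarrow>
      (\<exists>B \<in> K\<^sub>0. \<exists>C. ordered_version \<Upsilon>\<^sub>0 B C \<and> s = encoding (\<Upsilon>\<^sub>0 @ [2]) C)"
    using assms(2) unfolding ptime_class_def by blast
  obtain p :: "nat poly" where p: "\<And>s. tm_state_at M s (poly p (length s)) \<in> {tm_accept M, tm_reject M}"
    using M(2) by (auto simp: tm_polytime_def)
  let ?ar = "order_simulation.arity_list \<Upsilon>\<^sub>0"
  \<comment> \<open>Program and polynomials have to be fixed before \<open>A\<close> is given,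
    whereas \<open>duration\<close>, \<open>initial_weight\<close> and \<open>growth\<close> belong
    to a locale depending on \<open>A\<close>. They are therefore restated as functions of
    \<open>x = |U|\<close>.\<close>
  define tm_time where "tm_time x = poly p (\<Sum>a \<leftarrow> ?ar. x ^ a)" for x
  define dur where "dur x = (\<Sum>i<length ?ar. cost (?ar ! i) x) + tm_time x + 2" for x
  define iw where "iw x = 17 + 5 * (x * x) + (\<Sum>i<length ?ar. 17 + i + ?ar ! i + x)" for x :: nat
  define gr where "gr x = 40 + length ?ar + 5 * sum_list ?ar + tm_states M + tm_symbols M + x" for x
  have pb: "poly_bounded dur" "poly_bounded iw" "poly_bounded gr"
    unfolding dur_def tm_time_def iw_def gr_def
    by (intro poly_bounded_add poly_bounded_sum poly_bounded_cost poly_bounded_poly poly_bounded_mult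
        poly_bounded_sum_list poly_bounded_power poly_bounded_const poly_bounded_id)+
  have pb': "poly_bounded (\<lambda>x. x + dur x + 2)" "poly_bounded (\<lambda>x. iw x + dur x * gr x)"
    by (intro poly_bounded_add poly_bounded_mult poly_bounded_id poly_bounded_const pb)+
  obtain tp where tp: "\<forall>x n. x \<le> n \<longrightarrow> int (x + dur x + 2) \<le> poly tp (int n)"
    using poly_bounded_int[OF pb'(1)] by blast
  obtain wp where wp: "\<forall>x n. x \<le> n \<longrightarrow> int (iw x + dur x * gr x) \<le> poly wp (int n)"
    using poly_bounded_int[OF pb'(2)] by blast
  \<comment> \<open>The run has at most \<open>tp + 1\<close> states. Each has at most
    \<open>n + 3\<close> active objects for the atoms, the two truth values and the family itself,
    plus at most \<open>n ^ j\<close> configurations of size at most \<open>wp\<close>.\<close>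
  define sp where "sp = (tp + 1) * ([:3, 1:] + [:0, 1:] ^ j * wp)"
  define P where "P = \<lparr>prog = order_simulation.simulation \<Upsilon>\<^sub>0 M, time_poly = tp, space_poly = sp\<rparr>"
  have "is_ptime_program (\<Upsilon>\<^sub>0 @ [1]) P"
    using order_simulation.is_program_simulation by (simp add: is_ptime_program_def P_def)
  moreover have "(U_part \<Upsilon>\<^sub>0 A \<in> K\<^sub>0 \<longrightarrow> accepts P A) \<and> (U_part \<Upsilon>\<^sub>0 A \<notin> K\<^sub>0 \<longrightarrow> rejects P A)"
    if A: "A \<in> K" for A
  proof -
    interpret order_simulation_on \<Upsilon>\<^sub>0 M A
      using A M(1) by unfold_locales (simp_all add: K_def)
    let ?n = "card (universe A)" and ?b = "U_part \<Upsilon>\<^sub>0 A \<in> K\<^sub>0"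
    have fin: "finite (universe A)" using struct by (simp add: is_struct_def)
    have mn: "m \<le> ?n" by (rule card_mono[OF fin U_set_subset])
    have fact: "fact m \<le> ?n ^ j"
      using A by (simp add: K_def U_part_def reduct_def substructure_def)
    have verdict: "tm_state_at M (encoding (\<Upsilon>\<^sub>0 @ [2]) (ordered zs)) (tm_time m) =
        (if ?b then tm_accept M else tm_reject M)"
      if zs: "distinct zs" "set zs = U_set \<Upsilon>\<^sub>0 A" for zs
    proof -
      have "tm_accepts M (encoding (\<Upsilon>\<^sub>0 @ [2]) (ordered zs)) \<longleftrightarrow> ?b"
        by (rule ptime_class_encoding[OF K\<^sub>0 M(3) ordered_version_ordered[OF zs] is_struct_U_part])
      then show ?thesis
        using tm_state_verdict[OF M(1) p[of "encoding (\<Upsilon>\<^sub>0 @ [2]) (ordered zs)"]]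
        by (simp add: tm_time_def length_encoding_ordered[OF zs])
    qed
    have eqs: "duration (tm_time m) = dur m" "initial_weight = iw m" "growth = gr m"
      by (simp_all add: duration_def dur_def initial_weight_def iw_def growth_def gr_def fcard.rep_eq)
    obtain l where l: "l \<le> m + dur m + 2" "run_reaches simulation A l"
        "halted (run_state simulation A l)"
        "dyn (run_state simulation A l) Output [] = bool_obj ?b"
      and act: "\<forall>i \<le> l. finite (active (run_state simulation A i)) \<and>
        card (active (run_state simulation A i)) \<le> ?n + 2 + (1 + fact m * (iw m + dur m * gr m))"
      using simulation_run[OF verdict] unfolding bound_def eqs by blast
    let ?Act = "\<Union>i \<le> l. active (run_state simulation A i)"
    let ?B = "?n + 3 + fact m * (iw m + dur m * gr m)"
    have time: "int l \<le> poly tp (int ?n)" using l(1) tp[rule_format, OF mn] by linarith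
    have "card ?Act \<le> (\<Sum>i \<le> l. card (active (run_state simulation A i)))"
      by (rule card_UN_le) simp
    also have "\<dots> \<le> of_nat (card {..l}) * ?B"
      using act by (intro sum_bounded_above) (auto simp: algebra_simps)
    finally have "card ?Act \<le> (l + 1) * ?B" by simp
    then have "int (card ?Act) \<le> int (l + 1) * int ?B"
      by (metis of_nat_mono of_nat_mult)
    also have "\<dots> \<le> (poly tp (int ?n) + 1) * (int ?n + 3 + int ?n ^ j * poly wp (int ?n))"
    proof (intro mult_mono)
      have "int (fact m) \<le> int ?n ^ j" using fact by (metis of_nat_le_iff of_nat_power)
      then have "int (fact m) * int (iw m + dur m * gr m) \<le> int ?n ^ j * poly wp (int ?n)"
        using wp[rule_format, OF mn] by (intro mult_mono) auto
      then show "int ?B \<le> int ?n + 3 + int ?n ^ j * poly wp (int ?n)" by simp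
    qed (use time in auto)
    also have "\<dots> = poly sp (int ?n)" by (simp add: sp_def poly_power algebra_simps)
    finally have "bounded_segment P A l"
      using l(2) time act by (auto simp: bounded_segment_def P_def Let_def)
    \<comment> \<open>A halted state ends the run, so no longer segment exists and \<open>l\<close>
      is the maximal length.\<close>
    moreover have "\<not> bounded_segment P A k" if "k > l" for k
      using l(3) that by (auto simp: bounded_segment_def run_reaches_def P_def)
    ultimately have "ptime_run_length P A l" by (auto simp: ptime_run_length_def)
    then show ?thesis
      using l(3,4) unfolding accepts_def rejects_def
      by (auto simp: P_def bool_obj_def intro!: exI[of _ l])
  qed
  ultimately show ?thesis by blast
qed

end
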